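(* Let $n\ge 1$. The number of one-dimensional $T$-orbits in the degenerate flag variety $\mathcal F^a_{n+1}$ is finite. These orbits are of the form $U_{i,j}\,p_{\mathbf S}\setminus \{p_{\mathbf S}\}$, where $\mathbf S$ is an admissible collection and $(i,j)$ is an $\mathbf S$-effective pair. The edge of the moment graph of $\mathcal F^a_{n+1}$ corresponding to the orbit $U_{i,j}\,p_{\mathbf S}\setminus \{p_{\mathbf S}\}$ is labeled by $\alpha_{i,j}$.
   Context: Work over $\mathbb C$. Let $W$ be a vector space with basis $w_1,\dots,w_{n+1}$, and let $pr_k:W\to W$ be the linear map with $pr_kw_k=0$ and $pr_kw_i=w_i$ for $i\ne k$. The degenerate flag variety $\mathcal F^a_{n+1}\subset\prod_{k=1}^n\mathrm{Gr}_k(W)$ consists of collections $(V_1,\dots,V_n)$ with $\dim V_k=k$ and $pr_{k+1}V_k\subset V_{k+1}$ for $1\le k\le n-1$. A collection $\mathbf S=(S_1,\dots,S_n)$ of subsets of $\{1,\dots,n+1\}$ with $\#S_k=k$ is called admissible if $S_k\subset S_{k+1}\cup\{k+1\}$ for $1\le k\le n-1$; put $p_{\mathbf S}=(V_k)_{k=1}^n$ with $V_k=\mathrm{span}(w_i: i\in S_k)$. Let $Q$ be the equioriented quiver $1\to2\to\dots\to n$ of type $A_n$. Let $P_k$ (resp. $I_k$) be the indecomposable representation of $Q$ which is one-dimensional at the vertices $k,\dots,n$ (resp. $1,\dots,k$), with identity maps between them, and zero elsewhere. Let $P=\bigoplus_{k=1}^n P_k$, $I=\bigoplus_{k=1}^n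 I_k$, $M=P\oplus I$. Identify $M$ with the representation having $M_k=W$ at each vertex $k$ and $pr_{k+1}$ on the arrow $k\to k+1$: the summand $P_k$ is spanned by the copies of $w_k$ at vertices $k,\dots,n$, and $I_k$ is spanned by the copies of $w_{k+1}$ at vertices $1,\dots,k$. Then $\mathcal F^a_{n+1}$ is the quiver Grassmannian $\mathrm{Gr}_{\mathbf{dim}P}(M)$ of subrepresentations of $M$ of dimension vector $\mathbf{dim}P=(1,2,\dots,n)$, so $\mathrm{Aut}(M)$ acts on it. Denote the summands by $R_1=P_n,\ R_2=P_{n-1},\dots,R_n=P_1,\ R_{n+1}=I_n,\ R_{n+2}=I_{n-1},\dots,R_{2n}=I_1$. Let $T\cong(\mathbb C^* )^{2n}\subset\mathrm{Aut}(M)$ be the torus in which the $i$-th factor scales $R_i$. The $T$-fixed points are exactly the points $p_{\mathbf S}$ with $\mathbf S$ admissible. For $1\le i<j\le 2n$ with $j-i\le n$ the space $\mathrm{Hom}(R_i,R_j)$ is one-dimensional; fix $0\ne\gamma$ in it, viewed as an endomorphism of $M$, and put $U_{i,j}=\{\mathrm{Id}+c\gamma: c\in\mathbb C\}\subset\mathrm{Aut}(M)$. Such a pair $(i,j)$ is called $\mathbf S$-effective if $p_{\mathbf S}\cap R_i\neq0$ and $\gamma(p_{\mathbf S}\cap R_i)\not\subset p_{\mathbf S}$ (here $p_{\mathbf S}$ is viewed as a subrepresentation of $M$). The moment graph has the $T$-fixed points as vertices; its edges correspond to the one-dimensional $T$-orbits $L$, the edge $L$ connecting the two $T$-fixed points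 in the closure of $L$. The scalars act trivially, and the Lie algebra $\mathfrak t$ of the torus (modulo scalars) is identified with the traceless diagonal $2n\times2n$ matrices $\mathrm{diag}(x_1,\dots,x_{2n})$, $x_i$ corresponding to $R_i$. The label of $L$ is a non-zero element $\alpha_L\in\mathfrak t^*$ (determined up to a non-zero scalar) in the annihilator of the hyperplane given by the Lie algebra of the stabilizer of a point of $L$. Finally $\alpha_{i,j}\in\mathfrak t^*$ is given by $\alpha_{i,j}(\mathrm{diag}(x_1,\dots,x_{2n}))=x_i-x_j$. *)

theory Defs
  imports "HOL-Analysis.Analysis" "HOL-Library.Function_Algebras"
begin

section \<open>The vector space W\<close>

text \<open>
  Since the dimension \<open>n + 1\<close> enters through arithmetic on the indices, vectors are functions
  \<open>nat \<Rightarrow> complex\<close>, and \<open>W n\<close> is the subspace of those supported on \<open>{1..n+1}\<close>.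
\<close>

type_synonym cvec = "nat \<Rightarrow> complex"

definition cscale :: "complex \<Rightarrow> cvec \<Rightarrow> cvec" where
  "cscale c v = (\<lambda>i. c * v i)"

global_interpretation cvec: vector_space cscale
  by unfold_locales (auto simp: cscale_def fun_eq_iff algebra_simps)

definition coord_space :: "nat \<Rightarrow> cvec set" where
  "coord_space m = {v. \<forall>i. i \<notin> {1..m} \<longrightarrow> v i = 0}"

abbreviation W :: "nat \<Rightarrow> cvec set" where
  "W n \<equiv> coord_space (n + 1)"

definition w :: "nat \<Rightarrow> cvec" where
  "w k = (\<lambda>i. if i = k then 1 else 0)"

definition pr :: "nat \<Rightarrow> cvec \<Rightarrow> cvec" where
  "pr k v = (\<lambda>i. if i = k then 0 else v i)"

section \<open>The degenerate flag variety\<close>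

definition gr_prod :: "nat \<Rightarrow> (nat \<Rightarrow> cvec set) set" where
  "gr_prod n = (\<Pi>\<^sub>E k\<in>{1..n}. {V. cvec.subspace V \<and> V \<subseteq> W n \<and> cvec.dim V = k})"

definition deg_flag :: "nat \<Rightarrow> (nat \<Rightarrow> cvec set) set" where
  "deg_flag n = {V \<in> gr_prod n. \<forall>k\<in>{1..<n}. pr (k + 1) ` V k \<subseteq> V (k + 1)}"

definition admissible :: "nat \<Rightarrow> (nat \<Rightarrow> nat set) \<Rightarrow> bool" where
  "admissible n S \<longleftrightarrow>
     (\<forall>k\<in>{1..n}. S k \<subseteq> {1..n+1} \<and> card (S k) = k) \<and>
     (\<forall>k\<in>{1..<n}. S k \<subseteq> S (k + 1) \<union> {k + 1})"

definition coord_pt :: "nat \<Rightarrow> (nat \<Rightarrow> nat set) \<Rightarrow> (nat \<Rightarrow> cvec set)" where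
  "coord_pt n S = (\<lambda>k\<in>{1..n}. cvec.span (w ` S k))"

section \<open>The representation M and its endomorphisms\<close>

text \<open>
  \<open>M\<close> has the space \<open>W n\<close> at each vertex \<open>k \<in> {1..n}\<close> and the map \<open>pr (k + 1)\<close> on the arrow
  from \<open>k\<close> to \<open>k + 1\<close>. An endomorphism is a family of maps indexed by the vertices; only the
  values at vertices \<open>1..n\<close> and on \<open>W n\<close> are relevant.
\<close>

type_synonym cfam = "nat \<Rightarrow> cvec \<Rightarrow> cvec"

definition End_M :: "nat \<Rightarrow> cfam set" where
  "End_M n = {f.
     (\<forall>k\<in>{1..n}. f k ` W n \<subseteq> W n \<and>
        (\<forall>u\<in>W n. \<forall>v\<in>W n. f k (u + v) = f k u + f k v) \<and>
        (\<forall>c. \<forall>v\<in>W n. f k (cscale c v) = cscale c (f k v))) \<and>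
     (\<forall>k\<in>{1..<n}. \<forall>v\<in>W n. f (k + 1) (pr (k + 1) v) = pr (k + 1) (f k v))}"

definition act :: "nat \<Rightarrow> cfam \<Rightarrow> (nat \<Rightarrow> cvec set) \<Rightarrow> (nat \<Rightarrow> cvec set)" where
  "act n g V = (\<lambda>k\<in>{1..n}. g k ` V k)"

text \<open>The indecomposable summands of \<open>M\<close>, as subspaces of \<open>W\<close> at each vertex \<open>k\<close>.\<close>

definition P_summand :: "nat \<Rightarrow> nat \<Rightarrow> nat \<Rightarrow> cvec set" where
  "P_summand n a k = (if k \<in> {a..n} then cvec.span {w a} else {0})"

definition I_summand :: "nat \<Rightarrow> nat \<Rightarrow> cvec set" where
  "I_summand b k = (if k \<in> {1..b} then cvec.span {w (b + 1)} else {0})"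

text \<open>\<open>R\<^sub>1 = P\<^sub>n, \<dots>, R\<^sub>n = P\<^sub>1\<close> and then \<open>I\<^sub>n, \<dots>, I\<^sub>1\<close>.\<close>

definition R :: "nat \<Rightarrow> nat \<Rightarrow> nat \<Rightarrow> cvec set" where
  "R n i = (if i \<le> n then P_summand n (n + 1 - i) else I_summand (2 * n + 1 - i))"

text \<open>
  \<open>Hom(R\<^sub>i, R\<^sub>j)\<close>, with its elements viewed as endomorphisms of \<open>M\<close>, that is, extended by zero
  to the other summands.
\<close>

definition Hom_R :: "nat \<Rightarrow> nat \<Rightarrow> nat \<Rightarrow> cfam set" where
  "Hom_R n i j = {f \<in> End_M n.
     (\<forall>k\<in>{1..n}. f k ` R n i k \<subseteq> R n j k) \<and>
     (\<forall>l\<in>{1..2*n} - {i}. \<forall>k\<in>{1..n}. \<forall>v\<in>R n l k. f k v = 0)}"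

definition nonzero_fam :: "nat \<Rightarrow> cfam \<Rightarrow> bool" where
  "nonzero_fam n f \<longleftrightarrow> (\<exists>k\<in>{1..n}. \<exists>v\<in>W n. f k v \<noteq> 0)"

definition unip :: "cfam \<Rightarrow> cfam set" where
  "unip \<gamma> = {(\<lambda>k v. v + cscale c (\<gamma> k v)) | c. True}"

definition unip_orbit :: "nat \<Rightarrow> cfam \<Rightarrow> (nat \<Rightarrow> cvec set) \<Rightarrow> (nat \<Rightarrow> cvec set) set" where
  "unip_orbit n \<gamma> V = (\<lambda>g. act n g V) ` unip \<gamma>"

definition hom_pair :: "nat \<Rightarrow> nat \<Rightarrow> nat \<Rightarrow> bool" where
  "hom_pair n i j \<longleftrightarrow> 1 \<le> i \<and> i < j \<and> j \<le> 2 * n \<and> j - i \<le> n"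

definition effective ::
  "nat \<Rightarrow> (nat \<Rightarrow> nat \<Rightarrow> cfam) \<Rightarrow> (nat \<Rightarrow> nat set) \<Rightarrow> nat \<Rightarrow> nat \<Rightarrow> bool" where
  "effective n \<gamma> S i j \<longleftrightarrow> hom_pair n i j \<and>
     (\<exists>k\<in>{1..n}. coord_pt n S k \<inter> R n i k \<noteq> {0}) \<and>
     (\<exists>k\<in>{1..n}. \<not> \<gamma> i j k ` (coord_pt n S k \<inter> R n i k) \<subseteq> coord_pt n S k)"

section \<open>The torus\<close>

definition torus :: "nat \<Rightarrow> (nat \<Rightarrow> complex) set" where
  "torus n = {1..2*n} \<rightarrow>\<^sub>E (UNIV - {0})"

text \<open>
  At vertex \<open>k\<close> the vector \<open>w l\<close> lies in the summand \<open>P\<^sub>l = R\<^bsub>n+1-l\<^esub>\<close> if \<open>l \<le> k\<close>, and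
  in \<open>I\<^bsub>l-1\<^esub> = R\<^bsub>2n+2-l\<^esub>\<close> otherwise.
\<close>

definition summand_index :: "nat \<Rightarrow> nat \<Rightarrow> nat \<Rightarrow> nat" where
  "summand_index n k l = (if l \<le> k then n + 1 - l else 2 * n + 2 - l)"

definition torus_aut :: "nat \<Rightarrow> (nat \<Rightarrow> complex) \<Rightarrow> cfam" where
  "torus_aut n t = (\<lambda>k v l. t (summand_index n k l) * v l)"

definition torus_orbit :: "nat \<Rightarrow> (nat \<Rightarrow> cvec set) \<Rightarrow> (nat \<Rightarrow> cvec set) set" where
  "torus_orbit n V = (\<lambda>t. act n (torus_aut n t) V) ` torus n"

definition torus_stab :: "nat \<Rightarrow> (nat \<Rightarrow> cvec set) \<Rightarrow> (nat \<Rightarrow> complex) set" where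
  "torus_stab n V = {t \<in> torus n. act n (torus_aut n t) V = V}"

definition torus_fixed :: "nat \<Rightarrow> (nat \<Rightarrow> cvec set) set" where
  "torus_fixed n = {V \<in> deg_flag n. \<forall>t\<in>torus n. act n (torus_aut n t) V = V}"

lemma torus_aut_scales_R:
  assumes "i \<in> {1..2*n}" "k \<in> {1..n}" "v \<in> R n i k"
  shows "torus_aut n t k v = cscale (t i) v"
proof (cases "i \<le> n")
  case True
  then have "v \<in> cvec.span {w (n + 1 - i)}" "n + 1 - i \<le> k \<or> v = 0"
    using assms(3) by (auto simp: R_def P_summand_def cvec.span_zero split: if_splits)
  then obtain c where c: "v = cscale c (w (n + 1 - i))"
    by (auto simp: cvec.span_singleton)
  show ?thesis
  proof
    fix l
    show "torus_aut n t k v l = cscale (t i) v l"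
    proof (cases "l = n + 1 - i")
      case l: True
      from \<open>n + 1 - i \<le> k \<or> v = 0\<close> show ?thesis
      proof
        assume "n + 1 - i \<le> k"
        then have "summand_index n k l = i" using l True assms(1) by (simp add: summand_index_def)
        then show ?thesis by (simp add: torus_aut_def cscale_def)
      qed (simp add: torus_aut_def cscale_def)
    qed (simp add: c torus_aut_def cscale_def w_def)
  qed
next
  case False
  then have "v \<in> cvec.span {w (2 * n + 2 - i)}" "k < 2 * n + 2 - i \<or> v = 0"
    using assms by (auto simp: R_def I_summand_def cvec.span_zero Suc_diff_le split: if_splits)
  then obtain c where c: "v = cscale c (w (2 * n + 2 - i))"
    by (auto simp: cvec.span_singleton)
  show ?thesis
  proof
    fix l
    show "torus_aut n t k v l = cscale (t i) v l"
    proof (cases "l = 2 * n + 2 - i")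
      case l: True
      from \<open>k < 2 * n + 2 - i \<or> v = 0\<close> show ?thesis
      proof
        assume "k < 2 * n + 2 - i"
        then have "summand_index n k l = i" using l assms(1) by (simp add: summand_index_def)
        then show ?thesis by (simp add: torus_aut_def cscale_def)
      qed (simp add: torus_aut_def cscale_def)
    qed (simp add: c torus_aut_def cscale_def w_def)
  qed
qed

section \<open>The Zariski topology and dimension\<close>

text \<open>
  The Zariski topology on the product of Grassmannians is the quotient topology of the one on
  the tuples of frames: \<open>A k 1, \<dots>, A k k\<close> is a basis of the \<open>k\<close>-th subspace, and a set is closed
  iff its preimage is cut out by polynomials in the coordinates \<open>A k l i\<close>.
\<close>

type_synonym frames = "nat \<Rightarrow> nat \<Rightarrow> cvec"

inductive_set frame_poly :: "nat \<Rightarrow> (frames \<Rightarrow> complex) set" for n where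
  const: "(\<lambda>A. c) \<in> frame_poly n"
| coord: "\<lbrakk>k \<in> {1..n}; l \<in> {1..k}; i \<in> {1..n+1}\<rbrakk> \<Longrightarrow> (\<lambda>A. A k l i) \<in> frame_poly n"
| add: "\<lbrakk>f \<in> frame_poly n; g \<in> frame_poly n\<rbrakk> \<Longrightarrow> (\<lambda>A. f A + g A) \<in> frame_poly n"
| mult: "\<lbrakk>f \<in> frame_poly n; g \<in> frame_poly n\<rbrakk> \<Longrightarrow> (\<lambda>A. f A * g A) \<in> frame_poly n"

text \<open>
  For \<open>V \<in> gr_prod n\<close> the \<open>k\<close> vectors spanning the \<open>k\<close>-dimensional space \<open>V k\<close> are
  automatically linearly independent.
\<close>

definition frames_of :: "nat \<Rightarrow> (nat \<Rightarrow> cvec set) \<Rightarrow> frames set" where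
  "frames_of n V = {A. \<forall>k\<in>{1..n}. cvec.span (A k ` {1..k}) = V k}"

definition zariski_closed :: "nat \<Rightarrow> (nat \<Rightarrow> cvec set) set \<Rightarrow> bool" where
  "zariski_closed n Z \<longleftrightarrow> Z \<subseteq> gr_prod n \<and>
     (\<exists>F \<subseteq> frame_poly n. \<forall>V\<in>gr_prod n. \<forall>A\<in>frames_of n V. V \<in> Z \<longleftrightarrow> (\<forall>f\<in>F. f A = 0))"

definition zariski :: "nat \<Rightarrow> (nat \<Rightarrow> cvec set) topology" where
  "zariski n = topology (\<lambda>U. U \<subseteq> gr_prod n \<and> zariski_closed n (gr_prod n - U))"

lemma zariski_closed_Un:
  assumes "zariski_closed n Y" "zariski_closed n Z"
  shows "zariski_closed n (Y \<union> Z)"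
proof -
  from assms(1) have "\<exists>F \<subseteq> frame_poly n.
      \<forall>V\<in>gr_prod n. \<forall>A\<in>frames_of n V. V \<in> Y \<longleftrightarrow> (\<forall>f\<in>F. f A = 0)"
    unfolding zariski_closed_def ..
  then obtain F where F: "F \<subseteq> frame_poly n"
      "\<And>V A. V \<in> gr_prod n \<Longrightarrow> A \<in> frames_of n V \<Longrightarrow> V \<in> Y \<longleftrightarrow> (\<forall>f\<in>F. f A = 0)"
    by auto
  from assms(2) have "\<exists>G \<subseteq> frame_poly n.
      \<forall>V\<in>gr_prod n. \<forall>A\<in>frames_of n V. V \<in> Z \<longleftrightarrow> (\<forall>f\<in>G. f A = 0)"
    unfolding zariski_closed_def ..
  then obtain G where G: "G \<subseteq> frame_poly n"
      "\<And>V A. V \<in> gr_prod n \<Longrightarrow> A \<in> frames_of n V \<Longrightarrow> V \<in> Z \<longleftrightarrow> (\<forall>f\<in>G. f A = 0)"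
    by auto
  define H where "H = (\<lambda>(f, g) A. f A * g A) ` (F \<times> G)"
  have "H \<subseteq> frame_poly n"
    using F(1) G(1) by (auto simp: H_def intro!: frame_poly.mult)
  moreover have "V \<in> Y \<union> Z \<longleftrightarrow> (\<forall>h\<in>H. h A = 0)"
    if "V \<in> gr_prod n" "A \<in> frames_of n V" for V A
  proof -
    have "(\<forall>h\<in>H. h A = 0) \<longleftrightarrow> (\<forall>f\<in>F. f A = 0) \<or> (\<forall>g\<in>G. g A = 0)"
      by (force simp: H_def)
    then show ?thesis using F(2)[OF that] G(2)[OF that] by simp
  qed
  ultimately have "\<exists>H \<subseteq> frame_poly n.
      \<forall>V\<in>gr_prod n. \<forall>A\<in>frames_of n V. V \<in> Y \<union> Z \<longleftrightarrow> (\<forall>f\<in>H. f A = 0)"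
    by (intro exI[of _ H]) simp
  moreover have "Y \<union> Z \<subseteq> gr_prod n"
    using assms unfolding zariski_closed_def by simp
  ultimately show ?thesis
    unfolding zariski_closed_def by simp
qed

lemma zariski_closed_Inter:
  assumes "\<And>Z. Z \<in> \<Z> \<Longrightarrow> zariski_closed n Z"
  shows "zariski_closed n (gr_prod n \<inter> \<Inter>\<Z>)"
proof -
  have "\<forall>Z\<in>\<Z>. \<exists>F \<subseteq> frame_poly n.
      \<forall>V\<in>gr_prod n. \<forall>A\<in>frames_of n V. V \<in> Z \<longleftrightarrow> (\<forall>f\<in>F. f A = 0)"
    using assms unfolding zariski_closed_def by blast
  from bchoice[OF this] obtain F where F: "\<forall>Z\<in>\<Z>. F Z \<subseteq> frame_poly n \<and>
      (\<forall>V\<in>gr_prod n. \<forall>A\<in>frames_of n V. V \<in> Z \<longleftrightarrow> (\<forall>f\<in>F Z. f A = 0))" ..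
  have "V \<in> gr_prod n \<inter> \<Inter>\<Z> \<longleftrightarrow> (\<forall>f\<in>\<Union>(F ` \<Z>). f A = 0)"
    if "V \<in> gr_prod n" "A \<in> frames_of n V" for V A
    using F that by simp
  moreover have "\<Union>(F ` \<Z>) \<subseteq> frame_poly n"
    using F by blast
  ultimately have "\<exists>G \<subseteq> frame_poly n.
      \<forall>V\<in>gr_prod n. \<forall>A\<in>frames_of n V. V \<in> gr_prod n \<inter> \<Inter>\<Z> \<longleftrightarrow> (\<forall>f\<in>G. f A = 0)"
    by (intro exI[of _ "\<Union>(F ` \<Z>)"]) simp
  then show ?thesis
    unfolding zariski_closed_def by simp
qed

lemma zariski_closed_empty: "zariski_closed n {}"
  unfolding zariski_closed_def
  by (intro conjI exI[of _ "{\<lambda>A. 1}"]) (auto intro: frame_poly.const)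

lemma istopology_zariski:
  "istopology (\<lambda>U. U \<subseteq> gr_prod n \<and> zariski_closed n (gr_prod n - U))"
  unfolding istopology_def
proof (intro conjI allI impI)
  fix U U' assume "U \<subseteq> gr_prod n \<and> zariski_closed n (gr_prod n - U)"
    "U' \<subseteq> gr_prod n \<and> zariski_closed n (gr_prod n - U')"
  then show "zariski_closed n (gr_prod n - U \<inter> U')"
    using zariski_closed_Un[of n "gr_prod n - U" "gr_prod n - U'"] by (simp add: Diff_Int)
next
  fix \<K> assume "\<forall>K\<in>\<K>. K \<subseteq> gr_prod n \<and> zariski_closed n (gr_prod n - K)"
  then have "zariski_closed n (gr_prod n \<inter> \<Inter>((\<lambda>K. gr_prod n - K) ` \<K>))"
    by (intro zariski_closed_Inter) auto
  moreover have "gr_prod n \<inter> \<Inter>((\<lambda>K. gr_prod n - K) ` \<K>) = gr_prod n - \<Union>\<K>"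
    by auto
  ultimately show "zariski_closed n (gr_prod n - \<Union>\<K>)" by simp
qed auto

lemma closedin_zariski: "closedin (zariski n) Z \<longleftrightarrow> zariski_closed n Z"
proof -
  have op: "openin (zariski n) = (\<lambda>U. U \<subseteq> gr_prod n \<and> zariski_closed n (gr_prod n - U))"
    unfolding zariski_def by (rule topology_inverse'[OF istopology_zariski])
  have "openin (zariski n) (gr_prod n)"
    by (simp add: op zariski_closed_empty)
  moreover have "topspace (zariski n) \<subseteq> gr_prod n"
    unfolding topspace_def op by (rule Union_least) simp
  ultimately have top: "topspace (zariski n) = gr_prod n"
    by (intro subset_antisym openin_subset)
  have "zariski_closed n Z \<Longrightarrow> Z \<subseteq> gr_prod n"
    unfolding zariski_closed_def by (rule conjunct1)
  then show ?thesis
    by (auto simp only: closedin_def op top double_diff[OF _ subset_refl])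
qed

definition irreducible_in :: "'a topology \<Rightarrow> 'a set \<Rightarrow> bool" where
  "irreducible_in X Z \<longleftrightarrow> Z \<noteq> {} \<and>
     (\<forall>A B. closedin X A \<and> closedin X B \<and> Z \<subseteq> A \<union> B \<longrightarrow> Z \<subseteq> A \<or> Z \<subseteq> B)"

text \<open>Krull dimension; the empty space gets dimension 0 here.\<close>

definition krull_dim :: "'a topology \<Rightarrow> enat" where
  "krull_dim X = (SUP m \<in> {m. \<exists>Z. (\<forall>i\<le>m. closedin X (Z i) \<and> irreducible_in X (Z i)) \<and>
                                  (\<forall>i<m. Z i \<subset> Z (Suc i))}. enat m)"

definition one_dim_orbits :: "nat \<Rightarrow> (nat \<Rightarrow> cvec set) set set" where
  "one_dim_orbits n =
     {L. (\<exists>V\<in>deg_flag n. L = torus_orbit n V) \<and> krull_dim (subtopology (zariski n) L) = 1}"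

section \<open>The moment graph\<close>

text \<open>The Lie algebra of the torus modulo scalars: traceless diagonal matrices.\<close>

definition lie_torus :: "nat \<Rightarrow> cvec set" where
  "lie_torus n = {x \<in> coord_space (2 * n). (\<Sum>i\<in>{1..2*n}. x i) = 0}"

text \<open>The Lie algebra (modulo scalars) of a closed subgroup \<open>H\<close> containing the scalars.\<close>

definition lie_alg :: "nat \<Rightarrow> (nat \<Rightarrow> complex) set \<Rightarrow> cvec set" where
  "lie_alg n H = {x \<in> lie_torus n. \<forall>s. (\<lambda>i\<in>{1..2*n}. exp (s * x i)) \<in> H}"

definition lie_dual :: "nat \<Rightarrow> (cvec \<Rightarrow> complex) set" where
  "lie_dual n = {\<phi> \<in> extensional (lie_torus n).
     (\<forall>x\<in>lie_torus n. \<forall>y\<in>lie_torus n. \<phi> (x + y) = \<phi> x + \<phi> y) \<and>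
     (\<forall>c. \<forall>x\<in>lie_torus n. \<phi> (cscale c x) = c * \<phi> x)}"

definition alpha :: "nat \<Rightarrow> nat \<Rightarrow> nat \<Rightarrow> (cvec \<Rightarrow> complex)" where
  "alpha n i j = (\<lambda>x\<in>lie_torus n. x i - x j)"

definition scalar_class :: "nat \<Rightarrow> (cvec \<Rightarrow> complex) \<Rightarrow> (cvec \<Rightarrow> complex) set" where
  "scalar_class n \<phi> = {(\<lambda>x\<in>lie_torus n. c * \<phi> x) | c. c \<noteq> 0}"

record ('v, 'e, 'l) moment_graph =
  verts :: "'v set"
  edges :: "'e set"
  ends :: "'e \<Rightarrow> 'v set"
  labels :: "'e \<Rightarrow> 'l set"

text \<open>
  A label is only determined up to a non-zero scalar, so \<open>labels\<close> assigns to an edge the set of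
  all admissible choices.
\<close>

definition flag_moment_graph ::
  "nat \<Rightarrow> (nat \<Rightarrow> cvec set, (nat \<Rightarrow> cvec set) set, cvec \<Rightarrow> complex) moment_graph" where
  "flag_moment_graph n =
     \<lparr>verts = torus_fixed n,
      edges = one_dim_orbits n,
      ends = (\<lambda>L. torus_fixed n \<inter> (zariski n closure_of L)),
      labels = (\<lambda>L. {\<phi> \<in> lie_dual n. (\<exists>x\<in>lie_torus n. \<phi> x \<noteq> 0) \<and>
                       (\<forall>V\<in>L. \<forall>x\<in>lie_alg n (torus_stab n V). \<phi> x = 0)})\<rparr>"

section \<open>Non-zero elements of the spaces of homomorphisms\<close>

text \<open>\<open>R n i\<close> is spanned by copies of \<open>w (basis_index n i)\<close>.\<close>

definition basis_index :: "nat \<Rightarrow> nat \<Rightarrow> nat" where "basis_index n i = (if i \<le> n then n + 1 - i else 2*n+2-i)"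
definition std_hom :: "nat \<Rightarrow> nat \<Rightarrow> nat \<Rightarrow> cfam" where
 "std_hom n i j k v = (if summand_index n k (basis_index n i) = i \<and> summand_index n k (basis_index n j) = j
    then cscale (v (basis_index n i)) (w (basis_index n j)) else 0)"

lemma R_eq_span: assumes "i \<in> {1..2*n}" "k \<in> {1..n}"
  shows "R n i k = (if summand_index n k (basis_index n i) = i then cvec.span {w (basis_index n i)} else {0})"
proof (cases "i \<le> n")
  case True
  then have "summand_index n k (basis_index n i) = i \<longleftrightarrow> n+1-i \<le> k"
    using assms by (auto simp: summand_index_def basis_index_def)
  with True assms show ?thesis by (auto simp: R_def P_summand_def basis_index_def)
next
  case False
  then have "summand_index n k (basis_index n i) = i \<longleftrightarrow> k \<le> 2*n+1-i"
    using assms by (auto simp: summand_index_def basis_index_def)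
  with False assms show ?thesis by (auto simp: R_def I_summand_def basis_index_def Suc_diff_le)
qed

lemma w_in_W: "i \<in> {1..2*n} \<Longrightarrow> w (basis_index n i) \<in> W n"
  by (auto simp: w_def coord_space_def basis_index_def)

lemma std_hom_commute: assumes "hom_pair n i j" "k \<in> {1..<n}"
  shows "std_hom n i j (k+1) (pr (k+1) v) = pr (k+1) (std_hom n i j k v)"
proof -
  have ij: "1 \<le> i" "i < j" "j \<le> 2*n" "j \<le> n + i" using assms by (auto simp: hom_pair_def)
  have si: "summand_index n m (basis_index n i) = i \<longleftrightarrow> (if i \<le> n then n+1-i \<le> m else m \<le> 2*n+1-i)" if "m\<le>n" for m
    using ij that by (auto simp: summand_index_def basis_index_def)
  have sj: "summand_index n m (basis_index n j) = j \<longleftrightarrow> (if j \<le> n then n+1-j \<le> m else m \<le> 2*n+1-j)" if "m\<le>n" for m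
    using ij that by (auto simp: summand_index_def basis_index_def)
  have k: "k \<le> n" "k + 1 \<le> n" using assms(2) by auto
  let ?a = "basis_index n i" and ?b = "basis_index n j"
  have c1: "summand_index n (k+1) ?a = i \<and> summand_index n (k+1) ?b = j \<and> k + 1 \<noteq> ?a \<Longrightarrow>
     summand_index n k ?a = i \<and> summand_index n k ?b = j \<and> k + 1 \<noteq> ?b"
    unfolding si[OF k(1)] sj[OF k(1)] si[OF k(2)] sj[OF k(2)]
    using ij k by (cases "i \<le> n"; cases "j \<le> n"; simp add: basis_index_def; linarith)
  have c2: "summand_index n k ?a = i \<and> summand_index n k ?b = j \<and> k + 1 \<noteq> ?b \<Longrightarrow>
     summand_index n (k+1) ?a = i \<and> summand_index n (k+1) ?b = j \<and> k + 1 \<noteq> ?a"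
    unfolding si[OF k(1)] sj[OF k(1)] si[OF k(2)] sj[OF k(2)]
    using ij k by (cases "i \<le> n"; cases "j \<le> n"; simp add: basis_index_def; linarith)
  show ?thesis
  proof
    fix l
    show "std_hom n i j (k+1) (pr (k+1) v) l = pr (k+1) (std_hom n i j k v) l"
    proof (cases "l = ?b")
      case False
      then show ?thesis by (simp add: std_hom_def pr_def cscale_def w_def)
    next
      case l: True
      show ?thesis
      proof (cases "summand_index n (k+1) ?a = i \<and> summand_index n (k+1) ?b = j \<and> k + 1 \<noteq> ?a")
        case True
        from c1[OF True] True show ?thesis unfolding l by (simp add: std_hom_def pr_def)
      next
        case False
        then have f: "\<not> (summand_index n k ?a = i \<and> summand_index n k ?b = j \<and> k + 1 \<noteq> ?b)" using c2 by blast
        have "std_hom n i j (k+1) (pr (k+1) v) ?b = 0"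
          using False by (auto simp only: std_hom_def pr_def cscale_def split: if_split) simp_all
        moreover have "pr (k+1) (std_hom n i j k v) ?b = 0"
          using f by (auto simp only: std_hom_def pr_def cscale_def split: if_split) simp_all
        ultimately show ?thesis unfolding l by simp
      qed
    qed
  qed
qed

lemma Hom_R_nonzero: "hom_pair n i j \<Longrightarrow> \<exists>g \<in> Hom_R n i j. nonzero_fam n g"
proof (intro bexI[of _ "std_hom n i j"])
  assume h: "hom_pair n i j"
  then have ij: "1 \<le> i" "i < j" "j \<le> 2*n" "j \<le> n + i" by (auto simp: hom_pair_def)
  define k where "k = (if i \<le> n then n+1-i else 1)"
  have si: "summand_index n m (basis_index n i) = i \<longleftrightarrow> (if i \<le> n then n+1-i \<le> m else m \<le> 2*n+1-i)" if "m\<le>n" for m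
    using ij that by (auto simp: summand_index_def basis_index_def)
  have sj: "summand_index n m (basis_index n j) = j \<longleftrightarrow> (if j \<le> n then n+1-j \<le> m else m \<le> 2*n+1-j)" if "m\<le>n" for m
    using ij that by (auto simp: summand_index_def basis_index_def)
  have k: "k \<in> {1..n}" using ij by (auto simp: k_def)
  have kk: "k \<le> n" using k by simp
  have "std_hom n i j k (w (basis_index n i)) = w (basis_index n j)"
    using ij si[OF kk] sj[OF kk] by (auto simp: std_hom_def k_def cscale_def w_def fun_eq_iff)
  moreover have "w (basis_index n j) \<noteq> 0" by (auto simp: w_def fun_eq_iff)
  moreover have "w (basis_index n i) \<in> W n" using ij by (intro w_in_W) auto
  ultimately show "nonzero_fam n (std_hom n i j)"
    unfolding nonzero_fam_def using k by (intro bexI[of _ k] bexI[of _ "w (basis_index n i)"]) simp_all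
  have sub: "cvec.subspace (W n)" 
    by (auto simp: cvec.subspace_def coord_space_def cscale_def)
  have wj: "w (basis_index n j) \<in> W n" using ij by (intro w_in_W) auto
  have "std_hom n i j \<in> End_M n"
  proof -
    have "std_hom n i j k v \<in> W n" for k v
      using cvec.subspace_scale[OF sub wj] cvec.subspace_0[OF sub] by (simp add: std_hom_def)
    moreover have "std_hom n i j k (u + v) = std_hom n i j k u + std_hom n i j k v" for k u v
      by (simp add: std_hom_def cvec.scale_left_distrib)
    moreover have "std_hom n i j k (cscale c v) = cscale c (std_hom n i j k v)" for k c v
      by (simp add: std_hom_def cscale_def fun_eq_iff)
    ultimately show ?thesis
      unfolding End_M_def using std_hom_commute[OF h] by (simp add: image_subset_iff)
  qed
  moreover have "std_hom n i j k v \<in> R n j k" if "k \<in> {1..n}" for k v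
  proof -
    have "j \<in> {1..2*n}" using ij by auto
    then show ?thesis using that
      using cvec.span_scale[OF cvec.span_base[OF singletonI]] by (simp add: R_eq_span std_hom_def cvec.span_zero)
  qed
  moreover have "std_hom n i j k v = 0" if "k \<in> {1..n}" "l \<in> {1..2*n} - {i}" "v \<in> R n l k" for k v l
  proof (cases "summand_index n k (basis_index n l) = l \<and> summand_index n k (basis_index n i) = i")
    case True
    then have "basis_index n l \<noteq> basis_index n i" using that by auto
    then show ?thesis using that True
      by (auto simp: R_eq_span std_hom_def cvec.span_singleton cscale_def w_def fun_eq_iff)
  next
    case False
    then show ?thesis using that
      by (auto simp: R_eq_span std_hom_def cscale_def fun_eq_iff)
  qed
  ultimately show "std_hom n i j \<in> Hom_R n i j"
    unfolding Hom_R_def by (simp add: image_subset_iff)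
qed

end

theory Submission
  imports Defs
begin

text \<open>
  At a vertex \<open>k\<close> the basis vector \<open>w l\<close> spans a copy of the summand with the number
  \<open>i = summand_index n k l\<close>, called the weight of \<open>w l\<close> at \<open>k\<close>, and the torus element \<open>t\<close> scales it by \<open>t i\<close>. The
  \<open>n + 1\<close> weights at one vertex are distinct. Order the basis at each vertex by weight and bring the components of a
  point \<open>V\<close> into reduced echelon form: \<open>V k\<close> is the row space of \<open>(1 | B k)\<close> with pivots \<open>J k\<close>, where a non-zero entry of
  \<open>B k\<close> has a column of larger weight than its row (\<open>echelon_form\<close>). The element \<open>t\<close> keeps the pivots and multiplies
  an entry whose row and column have the weights \<open>x\<close> and \<open>y\<close> by \<open>t y / t x\<close>. Hence the stabilizer of \<open>V\<close> is given by
  the equations \<open>t x = t y\<close> for the weight pairs \<open>(x, y)\<close> of the non-zero entries (\<open>act_torus_fixes_iff\<close>), and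
  the orbit is one-dimensional iff there is exactly one such pair.

  Without weight pairs, \<open>V\<close> is fixed and its orbit has dimension zero. If there are two of them, an orbit of a
  subtorus lies strictly between the point \<open>V\<close> and its orbit and is closed in the orbit
  (\<open>two_weight_pairs_krull_dim\<close>), so the dimension is at least two. The irreducible sets of the chain
  come from connecting any two points by a line in the torus: on a line, polynomial equations in the frames become
  polynomials in one variable (\<open>irreducible_by_curves\<close>). The closed sets are defined by linear and quadratic
  equations in the frames.

  With a single weight pair \<open>(i, j)\<close>, each \<open>V k\<close> is a coordinate subspace in which at most one basis vector is bent,
  from \<open>w a\<close> to \<open>w a + c w b\<close>, where \<open>w a\<close> and \<open>w b\<close> have the weights \<open>i\<close> and \<open>j\<close>. Since \<open>V\<close> is a
  subrepresentation, the pivots form an admissible collection \<open>S\<close> and the number \<open>c\<close> is the same at all the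
  vertices that it occurs at (\<open>single_weight_pair_bent_pt\<close>); these are the vertices that make \<open>(i, j)\<close> an \<open>S\<close>-effective
  pair. As \<open>Hom(R\<^sub>i, R\<^sub>j)\<close> is one-dimensional (\<open>Hom_R_scalar_multiple\<close>), this says that \<open>V\<close> is a translate of the
  coordinate point of \<open>S\<close> by a non-trivial element of \<open>U\<^bsub>i,j\<^esub>\<close>. Conversely, these translates form a punctured line with
  coordinate \<open>c\<close>. The torus acts on it through the character \<open>t j / t i\<close>, so it is one orbit, and its proper closed
  subsets are finite, so it has dimension one (\<open>krull_dim_bent_family\<close>).

  The stabilizer of a point of this orbit is \<open>{t. t i = t j}\<close>. Its Lie algebra is the kernel of
  \<open>alpha n i j\<close>, and the functionals that vanish on a hyperplane are multiples of each other.
\<close>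

section \<open>Subspaces as graphs over a set of coordinates\<close>

text \<open>
  The graph of the linear map that sends the coordinates indexed by \<open>J\<close> to the remaining ones by the
  matrix \<open>B\<close>; the row space of \<open>(1 | B)\<close>.
\<close>

definition graph_space :: "nat set \<Rightarrow> (nat \<Rightarrow> nat \<Rightarrow> complex) \<Rightarrow> cvec set" where
  "graph_space J B = {v. \<forall>l. l \<notin> J \<longrightarrow> v l = (\<Sum>p\<in>J. B p l * v p)}"

text \<open>
  The rows of \<open>(1 | B)\<close>, which form a basis of \<open>graph_space J B\<close>.
\<close>

definition graph_vec :: "nat set \<Rightarrow> (nat \<Rightarrow> nat \<Rightarrow> complex) \<Rightarrow> nat \<Rightarrow> cvec" where
  "graph_vec J B p = (\<lambda>l. if l \<in> J then (if l = p then 1 else 0) else B p l)"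

lemma cscale_apply [simp]: "cscale c v i = c * v i"
  by (simp add: cscale_def)

lemma cvec_sum_apply: "(\<Sum>p\<in>J. f p) l = (\<Sum>p\<in>J. f p (l::nat) :: complex)"
  by (induction J rule: infinite_finite_induct) auto

lemma subspace_graph_space: "cvec.subspace (graph_space J B)"
  by (auto simp: cvec.subspace_def graph_space_def sum.distrib ring_distribs
      sum_distrib_left mult.left_commute)

lemma graph_vec_in: "\<lbrakk>finite J; p \<in> J\<rbrakk> \<Longrightarrow> graph_vec J B p \<in> graph_space J B"
  by (simp add: graph_space_def graph_vec_def if_distrib[of "(*) _"] sum.delta cong: if_cong sum.cong)

lemma graph_space_expand:
  assumes "finite J" "v \<in> graph_space J B"
  shows "v = (\<Sum>p\<in>J. cscale (v p) (graph_vec J B p))"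
proof
  fix l
  show "v l = (\<Sum>p\<in>J. cscale (v p) (graph_vec J B p)) l"
    using assms by (cases "l \<in> J") (simp_all add: cvec_sum_apply graph_vec_def graph_space_def
        if_distrib[of "(*) _"] mult.commute cong: if_cong sum.cong)
qed

lemma span_graph_vec: 
  assumes "finite J" shows "cvec.span (graph_vec J B ` J) = graph_space J B"
proof (rule antisym)
  show "cvec.span (graph_vec J B ` J) \<subseteq> graph_space J B"
    by (rule cvec.span_minimal) (use assms in \<open>auto intro: graph_vec_in subspace_graph_space\<close>)
  show "graph_space J B \<subseteq> cvec.span (graph_vec J B ` J)"
  proof
    fix v assume "v \<in> graph_space J B"
    then show "v \<in> cvec.span (graph_vec J B ` J)"
      by (subst graph_space_expand[OF assms])
        (auto intro!: cvec.span_sum cvec.span_scale intro: cvec.span_base)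
  qed
qed

lemma inj_graph_vec: "inj_on (graph_vec J B) J"
proof (rule inj_onI)
  fix p q assume "p \<in> J" "q \<in> J" "graph_vec J B p = graph_vec J B q"
  then have "graph_vec J B p p = graph_vec J B q p" by simp
  then show "p = q" using \<open>p \<in> J\<close> by (simp add: graph_vec_def split: if_splits)
qed

lemma independent_graph_vec:
  assumes "finite J" shows "cvec.independent (graph_vec J B ` J)"
proof (rule cvec.independent_if_scalars_zero)
  fix f x assume s: "(\<Sum>x\<in>graph_vec J B ` J. cscale (f x) x) = 0" and "x \<in> graph_vec J B ` J"
  then obtain p where p: "p \<in> J" "x = graph_vec J B p" by auto
  have "(\<Sum>q\<in>J. cscale (f (graph_vec J B q)) (graph_vec J B q)) p = 0"
    using s by (simp add: sum.reindex[OF inj_graph_vec])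
  then show "f x = 0"
    using p assms by (simp add: cvec_sum_apply graph_vec_def
        if_distrib[of "(*) _"] cong: if_cong sum.cong)
qed (use assms in simp)

lemma dim_graph_space: "finite J \<Longrightarrow> cvec.dim (graph_space J B) = card J"
  by (metis card_image cvec.dim_span_eq_card_independent independent_graph_vec inj_graph_vec
      span_graph_vec)

lemma graph_space_subset_coord_space:
  assumes "J \<subseteq> {1..m}" "\<And>p l. B p l \<noteq> 0 \<Longrightarrow> l \<in> {1..m}"
  shows "graph_space J B \<subseteq> coord_space m"
  using assms by (fastforce simp: graph_space_def coord_space_def intro!: sum.neutral)

text \<open>
  Row reduction for the order of the coordinates given by \<open>key\<close>. The induction removes the coordinate \<open>x\<close>
  with the smallest key: if \<open>x\<close> does not vanish on \<open>V\<close>, it becomes a new pivot, whose row is a vector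
  \<open>u\<close> of \<open>V\<close> with \<open>u x = 1\<close> from which the old pivots have been cleared. That non-zero entries sit to
  the right of their pivot is what later makes every weight pair increasing.
\<close>

lemma echelon_form:
  fixes key :: "nat \<Rightarrow> nat"
  assumes "finite N" "inj_on key N" "cvec.subspace V" "\<forall>v\<in>V. \<forall>l. l \<notin> N \<longrightarrow> v l = 0"
  shows "\<exists>J B. J \<subseteq> N \<and> V = graph_space J B \<and>
    (\<forall>p l. B p l \<noteq> 0 \<longrightarrow> p \<in> J \<and> l \<in> N - J \<and> key p < key l)"
  using assms
proof (induction arbitrary: V rule: finite_ranking_induct[where f = "\<lambda>l. - int (key l)"])
  case empty
  then have "0 \<in> V" by (intro cvec.subspace_0)
  moreover have "v = 0" if "v \<in> V" for v
  proof
    fix l show "v l = 0 l" using empty.prems(3) that by simp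
  qed
  ultimately have "V = {0}" by blast
  also have "\<dots> = graph_space {} (\<lambda>_ _. 0)" by (auto simp: graph_space_def)
  finally show ?case by (intro exI[of _ "{}"] exI[of _ "\<lambda>_ _. 0"]) simp
next
  case (insert x N)
  show ?case
  proof (cases "x \<in> N")
    case True
    then have "insert x N = N" by blast
    have "inj_on key N" "\<forall>v\<in>V. \<forall>l. l \<notin> N \<longrightarrow> v l = 0"
      using insert.prems(1,3) \<open>insert x N = N\<close> by simp_all
    from insert.IH[OF this(1) insert.prems(2) this(2)] show ?thesis
      using \<open>insert x N = N\<close> by simp
  next
    case x: False
    have subV: "cvec.subspace V" by (fact insert.prems(2))
    define V' where "V' = {v \<in> V. v x = 0}"
    have sub': "cvec.subspace V'"
      using subV by (auto simp: V'_def cvec.subspace_0 cvec.subspace_add cvec.subspace_scale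
          intro!: cvec.subspaceI)
    have supp': "\<forall>v\<in>V'. \<forall>l. l \<notin> N \<longrightarrow> v l = 0"
      using insert.prems(3) by (auto simp: V'_def)
    have "inj_on key N" using insert.prems(1) by simp
    from insert.IH[of V', OF this sub' supp'] obtain J B where J: "J \<subseteq> N" "V' = graph_space J B"
      and B: "\<And>p l. B p l \<noteq> 0 \<Longrightarrow> p \<in> J \<and> l \<in> N - J \<and> key p < key l"
      by blast
    have Bx: "B p x = 0" for p using B x by blast
    show ?thesis
    proof (cases "V' = V")
      case True
      then show ?thesis using J B by (intro exI[of _ J] exI[of _ B]) blast
    next
      case False
      then obtain u0 where u0: "u0 \<in> V" "u0 x \<noteq> 0" unfolding V'_def by blast
      define u1 where "u1 = cscale (inverse (u0 x)) u0"
      have u1: "u1 \<in> V" "u1 x = 1"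
        using u0 subV by (auto simp: u1_def cvec.subspace_scale)
      \<comment> \<open>\<open>z\<close> is the vector of \<open>V'\<close> that agrees with \<open>u1\<close> on the old pivots.\<close>
      define z where "z = (\<lambda>l. if l \<in> J then u1 l else \<Sum>p\<in>J. B p l * u1 p)"
      have z: "z \<in> V'" unfolding J(2) by (simp add: z_def graph_space_def)
      define u where "u = u1 - z"
      have u: "u \<in> V" "u x = 1" "\<And>p. p \<in> J \<Longrightarrow> u p = 0"
        using u1 z subV by (auto simp: u_def V'_def z_def cvec.subspace_diff)
      have fJ: "finite J" and xJ: "x \<notin> J" using J(1) insert.hyps x by (auto intro: finite_subset)
      define C where "C = (\<lambda>p l. if p = x then (if l \<in> insert x J then 0 else u l) else B p l)"
      have "v \<in> V \<longleftrightarrow> v \<in> graph_space (insert x J) C" for v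
      proof -
        have "v \<in> V \<longleftrightarrow> v - cscale (v x) u \<in> V'"
        proof
          assume "v \<in> V"
          then show "v - cscale (v x) u \<in> V'"
            using u subV by (auto simp: V'_def cvec.subspace_diff cvec.subspace_scale)
        next
          assume "v - cscale (v x) u \<in> V'"
          then have "v - cscale (v x) u + cscale (v x) u \<in> V"
            using u subV unfolding V'_def 
            by (intro cvec.subspace_add cvec.subspace_scale) auto
          then show "v \<in> V" by simp
        qed
        also have "\<dots> \<longleftrightarrow> (\<forall>l. l \<notin> J \<longrightarrow> v l - v x * u l = (\<Sum>p\<in>J. B p l * v p))"
          unfolding J(2) using u(3) by (simp add: graph_space_def cong: sum.cong)
        also have "\<dots> \<longleftrightarrow> (\<forall>l. l \<notin> insert x J \<longrightarrow> v l - v x * u l = (\<Sum>p\<in>J. B p l * v p))"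
        proof -
          have "v x - v x * u x = (\<Sum>p\<in>J. B p x * v p)" using u(2) Bx by simp
          then show ?thesis by (metis insert_iff)
        qed
        also have "\<dots> \<longleftrightarrow> v \<in> graph_space (insert x J) C"
        proof -
          have "(\<Sum>p\<in>insert x J. C p l * v p) = v x * u l + (\<Sum>p\<in>J. B p l * v p)"
            if "l \<notin> insert x J" for l
          proof -
            have "(\<Sum>p\<in>J. C p l * v p) = (\<Sum>p\<in>J. B p l * v p)"
              using xJ by (intro sum.cong) (auto simp: C_def)
            then show ?thesis using fJ xJ that by (simp add: C_def)
          qed
          then show ?thesis by (auto simp: graph_space_def diff_eq_eq add.commute)
        qed
        finally show ?thesis .
      qed
      then have "V = graph_space (insert x J) C" by blast
      moreover have "p \<in> insert x J \<and> l \<in> insert x N - insert x J \<and> key p < key l"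
        if "C p l \<noteq> 0" for p l
      proof (cases "p = x")
        case True
        then have l: "l \<notin> insert x J" "u l \<noteq> 0" using that by (auto simp: C_def split: if_splits)
        then have lN: "l \<in> insert x N" using insert.prems(3) u(1) by blast
        then have "key x \<le> key l" using insert.hyps(2)[of l] by auto
        moreover have "key x \<noteq> key l" using insert.prems(1) lN l by (auto simp: inj_on_def)
        ultimately show ?thesis using True l lN by auto
      next
        case False
        then show ?thesis using that B[of p l] x by (auto simp: C_def)
      qed
      ultimately show ?thesis using J(1)
        by (intro exI[of _ "insert x J"] exI[of _ C]) blast
    qed
  qed
qed

text \<open>
  The positivity of the dimension makes an independent set of size \<open>cvec.dim V\<close> finite; without it,
  \<open>card\<close> and hence \<open>cvec.dim\<close> could be the default value \<open>0\<close> of an infinite set.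
\<close>

lemma subspace_eq_of_dim_le:
  assumes "cvec.subspace U" "U \<subseteq> V" "cvec.dim V \<le> cvec.dim U" "cvec.dim V > 0"
    "cvec.subspace V"
  shows "U = V"
proof -
  obtain B where B: "B \<subseteq> U" "cvec.independent B" "U \<subseteq> cvec.span B" "card B = cvec.dim U"
    using cvec.basis_exists by blast
  obtain C where C: "B \<subseteq> C" "C \<subseteq> V" "cvec.independent C" "V \<subseteq> cvec.span C"
    using cvec.maximal_independent_subset_extend[of B V] B assms(2) by blast
  have "card C = cvec.dim V" using cvec.dim_unique[OF C(2,4,3) refl] by simp
  moreover from this have "finite C" using assms(4) by (metis card.infinite less_irrefl)
  ultimately have "B = C" using C(1) B(4) assms(3) by (intro card_seteq) auto
  then have "V \<subseteq> U" using C B(1) cvec.span_minimal[OF B(1) assms(1)] by blast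
  then show ?thesis using assms by blast
qed

lemma span_image_linear:
  assumes "\<And>x y. g (x + y) = g x + g y" "\<And>c x. g (cscale c x) = cscale c (g x)"
  shows "cvec.span (g ` X) = g ` cvec.span X"
proof -
  have "module_hom cscale cscale g"
    unfolding module_hom_iff using assms cvec.module_axioms by auto
  then show ?thesis by (rule module_hom.span_image)
qed

section \<open>Irreducible sets in the Zariski topology\<close>

lemma frame_poly_along_curve:
  assumes "f \<in> frame_poly n" "\<forall>k l i. \<exists>p. \<forall>s. A s k l i = poly p s"
  shows "\<exists>p. \<forall>s. f (A s) = poly p s"
  using assms(1)
proof induction
  case (const c)
  show ?case by (rule exI[of _ "[:c:]"]) simp
next
  case (coord k l i)
  then show ?case using assms(2) by blast
next
  case (add f g)
  then obtain p q where "\<forall>s. f (A s) = poly p s" "\<forall>s. g (A s) = poly q s" by blast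
  then show ?case by (intro exI[of _ "p + q"]) simp
next
  case (mult f g)
  then obtain p q where "\<forall>s. f (A s) = poly p s" "\<forall>s. g (A s) = poly q s" by blast
  then show ?case by (intro exI[of _ "p * q"]) simp
qed

lemma zariski_closed_separate:
  assumes "zariski_closed n T" "V \<in> gr_prod n" "V \<notin> T" "A \<in> frames_of n V"
  obtains f where "f \<in> frame_poly n" "f A \<noteq> 0"
    "\<And>V' A'. \<lbrakk>V' \<in> gr_prod n; A' \<in> frames_of n V'; f A' \<noteq> 0\<rbrakk> \<Longrightarrow> V' \<notin> T"
proof -
  obtain F where F: "F \<subseteq> frame_poly n"
    "\<And>V A. V \<in> gr_prod n \<Longrightarrow> A \<in> frames_of n V \<Longrightarrow> V \<in> T \<longleftrightarrow> (\<forall>f\<in>F. f A = 0)"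
    using assms(1) unfolding zariski_closed_def by metis
  then obtain f where "f \<in> F" "f A \<noteq> 0" using assms by blast
  then show thesis using that[of f] F by blast
qed

text \<open>
  Two points of \<open>Z\<close> outside the closed sets \<open>C\<close> and \<open>D\<close>, respectively, are joined by a polynomial
  curve of frames. Along it an equation of \<open>C\<close> and one of \<open>D\<close> become non-zero polynomials in one variable,
  which have a common non-root \<open>s\<close> at which the curve is in \<open>Z\<close>; that point of \<open>Z\<close> is in
  neither set.
\<close>

lemma irreducible_by_curves:
  assumes "Z \<noteq> {}" "Z \<subseteq> L" "L \<subseteq> gr_prod n"
    and "\<And>V0 V1. \<lbrakk>V0 \<in> Z; V1 \<in> Z\<rbrakk> \<Longrightarrow> \<exists>A s0 s1.
      (\<forall>k l i. \<exists>p. \<forall>s. A s k l i = poly p s) \<and>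
      A s0 \<in> frames_of n V0 \<and> A s1 \<in> frames_of n V1 \<and>
      finite {s::complex. \<not> (\<exists>V\<in>Z. A s \<in> frames_of n V)}"
  shows "irreducible_in (subtopology (zariski n) L) Z"
  unfolding irreducible_in_def
proof (intro conjI allI impI)
  fix C D
  assume "closedin (subtopology (zariski n) L) C \<and> closedin (subtopology (zariski n) L) D
    \<and> Z \<subseteq> C \<union> D"
  then obtain C' D' where CD: "zariski_closed n C'" "C = C' \<inter> L" "zariski_closed n D'"
      "D = D' \<inter> L" "Z \<subseteq> C \<union> D"
    by (auto simp: closedin_subtopology closedin_zariski)
  show "Z \<subseteq> C \<or> Z \<subseteq> D"
  proof (rule ccontr)
    assume "\<not> (Z \<subseteq> C \<or> Z \<subseteq> D)"
    then obtain V0 V1 where V: "V0 \<in> Z" "V0 \<notin> C'" "V1 \<in> Z" "V1 \<notin> D'"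
      using CD assms(2) by auto
    then have gr: "V0 \<in> gr_prod n" "V1 \<in> gr_prod n" using assms by auto
    obtain A s0 s1 where A: "\<forall>k l i. \<exists>p. \<forall>s. A s k l i = poly p s"
      "A s0 \<in> frames_of n V0" "A s1 \<in> frames_of n V1"
      and fin: "finite {s::complex. \<not> (\<exists>V\<in>Z. A s \<in> frames_of n V)}"
      using assms(4)[OF V(1,3)] by auto
    obtain f where f: "f \<in> frame_poly n" "f (A s0) \<noteq> 0"
      "\<And>V' A'. \<lbrakk>V' \<in> gr_prod n; A' \<in> frames_of n V'; f A' \<noteq> 0\<rbrakk> \<Longrightarrow> V' \<notin> C'"
      using zariski_closed_separate[OF CD(1) gr(1) V(2) A(2)] by blast
    obtain g where g: "g \<in> frame_poly n" "g (A s1) \<noteq> 0"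
      "\<And>V' A'. \<lbrakk>V' \<in> gr_prod n; A' \<in> frames_of n V'; g A' \<noteq> 0\<rbrakk> \<Longrightarrow> V' \<notin> D'"
      using zariski_closed_separate[OF CD(3) gr(2) V(4) A(3)] by blast
    obtain p where p: "\<And>s. f (A s) = poly p s"
      using frame_poly_along_curve[OF f(1) A(1)] by blast
    obtain q where q: "\<And>s. g (A s) = poly q s"
      using frame_poly_along_curve[OF g(1) A(1)] by blast
    have "p \<noteq> 0" "q \<noteq> 0" using f(2) g(2) p q by auto
    then have "finite ({s. poly p s = 0} \<union> {s. poly q s = 0} \<union>
        {s. \<not> (\<exists>V\<in>Z. A s \<in> frames_of n V)})"
      using fin by (simp add: poly_roots_finite)
    from ex_new_if_finite[OF infinite_UNIV_char_0 this]
    obtain s V where s: "poly p s \<noteq> 0" "poly q s \<noteq> 0" and V: "V \<in> Z" "A s \<in> frames_of n V"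
      by auto
    have "V \<in> gr_prod n" using V(1) assms(2,3) by blast
    then have "V \<notin> C'" "V \<notin> D'" using f(3) g(3) V(2) s p q by simp_all
    then show False using V(1) CD by blast
  qed
qed (use assms in auto)

section \<open>Closed sets cut out by linear forms\<close>

definition lin_form :: "nat \<Rightarrow> (nat \<Rightarrow> complex) \<Rightarrow> cvec \<Rightarrow> complex" where
  "lin_form m c u = (\<Sum>x\<in>{1..m}. c x * u x)"

lemma lin_form_add: "lin_form m c (u + v) = lin_form m c u + lin_form m c v"
  and lin_form_scale: "lin_form m c (cscale a v) = a * lin_form m c v"
  by (auto simp: lin_form_def sum.distrib ring_distribs sum_distrib_left mult.left_commute)

lemma lin_form_0: "lin_form m c 0 = 0"
  by (simp add: lin_form_def)

lemma frame_poly_sum: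
  "(\<And>x. x \<in> X \<Longrightarrow> f x \<in> frame_poly n) \<Longrightarrow> (\<lambda>A. \<Sum>x\<in>X. f x A) \<in> frame_poly n"
  by (induction X rule: infinite_finite_induct) (auto intro: frame_poly.intros)

lemma frame_poly_diff:
  assumes "f \<in> frame_poly n" "g \<in> frame_poly n" shows "(\<lambda>A. f A - g A) \<in> frame_poly n"
  using frame_poly.add[OF assms(1) frame_poly.mult[OF frame_poly.const[of "- 1"] assms(2)]] by simp

lemma frame_poly_lin_form:
  "k \<in> {1..n} \<Longrightarrow> l \<in> {1..k} \<Longrightarrow> (\<lambda>A. lin_form (n + 1) c (A k l)) \<in> frame_poly n"
  unfolding lin_form_def by (intro frame_poly_sum frame_poly.mult frame_poly.const frame_poly.coord)

lemma frames_of_span: "\<lbrakk>A \<in> frames_of n V; k \<in> {1..n}\<rbrakk> \<Longrightarrow> V k = cvec.span (A k ` {1..k})"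
  by (simp add: frames_of_def)

lemma zariski_closed_lin_form:
  assumes "k \<in> {1..n}"
  shows "zariski_closed n {V \<in> gr_prod n. \<forall>u\<in>V k. lin_form (n + 1) c u = 0}"
  unfolding zariski_closed_def
proof (intro conjI exI ballI)
  let ?F = "(\<lambda>l A. lin_form (n + 1) c (A k l)) ` {1..k}"
  show "?F \<subseteq> frame_poly n" using frame_poly_lin_form[OF assms] by auto
  fix V A assume V: "V \<in> gr_prod n" and "A \<in> frames_of n V"
  then have sp: "V k = cvec.span (A k ` {1..k})" using assms by (simp add: frames_of_span)
  have "cvec.subspace {u. lin_form (n + 1) c u = 0}"
    by (auto intro!: cvec.subspaceI simp: lin_form_add lin_form_scale lin_form_0)
  from cvec.span_minimal[OF _ this, of "A k ` {1..k}"]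
  have "(\<forall>u\<in>V k. lin_form (n + 1) c u = 0) \<longleftrightarrow> (\<forall>l\<in>{1..k}. lin_form (n + 1) c (A k l) = 0)"
    unfolding sp using cvec.span_superset[of "A k ` {1..k}"] by blast
  then show "V \<in> {V \<in> gr_prod n. \<forall>u\<in>V k. lin_form (n + 1) c u = 0} \<longleftrightarrow> (\<forall>f\<in>?F. f A = 0)"
    using V by simp
qed auto

text \<open>
  The condition says that the two forms become linearly dependent on \<open>V k\<close>. It is quadratic in the
  frame, so it can be stated without Pluecker coordinates.
\<close>

lemma zariski_closed_proportional_forms:
  assumes "k \<in> {1..n}"
  shows "zariski_closed n {V \<in> gr_prod n. \<forall>u\<in>V k. \<forall>v\<in>V k.
    lin_form (n + 1) c u * lin_form (n + 1) d v = lin_form (n + 1) c v * lin_form (n + 1) d u}"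
    (is "zariski_closed n {V \<in> gr_prod n. \<forall>u\<in>V k. \<forall>v\<in>V k. ?e u v}")
  unfolding zariski_closed_def
proof (intro conjI exI ballI)
  let ?b = "\<lambda>u v. lin_form (n + 1) c u * lin_form (n + 1) d v -
    lin_form (n + 1) c v * lin_form (n + 1) d u"
  let ?F = "(\<lambda>(l, l') A. ?b (A k l) (A k l')) ` ({1..k} \<times> {1..k})"
  show "?F \<subseteq> frame_poly n" using frame_poly_lin_form[OF assms]
    by (auto intro!: frame_poly_diff frame_poly.mult)
  fix V A assume V: "V \<in> gr_prod n" and "A \<in> frames_of n V"
  then have sp: "V k = cvec.span (A k ` {1..k})" using assms by (simp add: frames_of_span)
  have 1: "cvec.subspace {u. \<forall>v\<in>X. ?b u v = 0}" for X
    by (auto intro!: cvec.subspaceI simp: lin_form_add lin_form_scale lin_form_0 algebra_simps)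
  have 2: "cvec.subspace {v. \<forall>u\<in>X. ?b u v = 0}" for X
    by (auto intro!: cvec.subspaceI simp: lin_form_add lin_form_scale lin_form_0 algebra_simps)
  have "(\<forall>u\<in>V k. \<forall>v\<in>V k. ?b u v = 0) \<longleftrightarrow> (\<forall>l\<in>{1..k}. \<forall>l'\<in>{1..k}. ?b (A k l) (A k l') = 0)"
    (is "?L \<longleftrightarrow> ?R")
  proof
    assume ?L then show ?R
      unfolding sp using cvec.span_superset[of "A k ` {1..k}"] by blast
  next
    assume ?R
    then have "V k \<subseteq> {v. \<forall>u\<in>A k ` {1..k}. ?b u v = 0}"
      unfolding sp by (intro cvec.span_minimal 2) blast
    then have "V k \<subseteq> {u. \<forall>v\<in>V k. ?b u v = 0}"
      by (subst sp) (intro cvec.span_minimal 1; blast)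
    then show ?L by blast
  qed
  then show "V \<in> {V \<in> gr_prod n. \<forall>u\<in>V k. \<forall>v\<in>V k. ?e u v} \<longleftrightarrow> (\<forall>f\<in>?F. f A = 0)"
    using V by (simp split: prod.splits)
qed auto

text \<open>
  The linear form whose kernel expresses the \<open>q\<close>-th defining equation of \<open>graph_space J B\<close>.
\<close>

definition column_form :: "nat set \<Rightarrow> (nat \<Rightarrow> nat \<Rightarrow> complex) \<Rightarrow> nat \<Rightarrow> nat \<Rightarrow> complex" where
  "column_form J B q x = (if x = q then 1 else if x \<in> J then - B x q else 0)"

lemma lin_form_column_form:
  assumes "J \<subseteq> {1..m}" "q \<in> {1..m}" "q \<notin> J"
  shows "lin_form m (column_form J B q) u = u q - (\<Sum>p\<in>J. B p q * u p)"
proof -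
  have "lin_form m (column_form J B q) u = (\<Sum>x\<in>insert q J. column_form J B q x * u x)"
    unfolding lin_form_def using assms
    by (intro sum.mono_neutral_right) (auto simp: column_form_def)
  also have "\<dots> = u q + (\<Sum>x\<in>J. column_form J B q x * u x)"
    using assms by (subst sum.insert) (auto simp: column_form_def intro: finite_subset)
  also have "(\<Sum>x\<in>J. column_form J B q x * u x) = (\<Sum>x\<in>J. - (B x q * u x))"
    using assms by (intro sum.cong) (auto simp: column_form_def)
  finally show ?thesis by (simp add: sum_negf)
qed

lemma gr_prodD:
  assumes "V \<in> gr_prod n" "k \<in> {1..n}"
  shows "cvec.subspace (V k)" "V k \<subseteq> W n" "cvec.dim (V k) = k"
  using assms unfolding gr_prod_def by (auto dest: PiE_mem)

lemma gr_prod_echelon: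
  fixes key :: "nat \<Rightarrow> nat"
  assumes "V \<in> gr_prod n" "k \<in> {1..n}" "inj_on key {1..n+1}"
  shows "\<exists>J B. J \<subseteq> {1..n+1} \<and> card J = k \<and> V k = graph_space J B \<and>
    (\<forall>p l. B p l \<noteq> 0 \<longrightarrow> p \<in> J \<and> l \<in> {1..n+1} - J \<and> key p < key l)"
proof -
  have "\<forall>v\<in>V k. \<forall>l. l \<notin> {1..n+1} \<longrightarrow> v l = 0"
    using gr_prodD(2)[OF assms(1,2)] by (auto simp: coord_space_def)
  from echelon_form[OF _ assms(3) gr_prodD(1)[OF assms(1,2)] this]
  obtain J B where JB: "J \<subseteq> {1..n+1}" "V k = graph_space J B"
    "\<forall>p l. B p l \<noteq> 0 \<longrightarrow> p \<in> J \<and> l \<in> {1..n+1} - J \<and> key p < key l" by auto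
  then have "card J = k"
    using dim_graph_space[of J B] gr_prodD(3)[OF assms(1,2)] by (auto dest: finite_subset)
  then show ?thesis using JB by blast
qed

text \<open>
  By equality of dimensions, \<open>V\<close> is the only point of the product of Grassmannians whose \<open>k\<close>-th component is
  contained in \<open>V k\<close> for all \<open>k\<close>, and containment is a system of linear equations in the frame.
\<close>

lemma zariski_closed_point:
  assumes "V \<in> gr_prod n"
  shows "zariski_closed n {V}"
proof -
  have "\<exists>J B. J \<subseteq> {1..n+1} \<and> V k = graph_space J B \<and> (\<forall>p l. B p l \<noteq> 0 \<longrightarrow> l \<in> {1..n+1})"
    if "k \<in> {1..n}" for k
    using gr_prod_echelon[OF assms that inj_on_id] by blast
  then obtain J B where J: "\<And>k. k \<in> {1..n} \<Longrightarrow> J k \<subseteq> {1..n+1}"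
    and V: "\<And>k. k \<in> {1..n} \<Longrightarrow> V k = graph_space (J k) (B k)"
    and B: "\<And>k p l. k \<in> {1..n} \<Longrightarrow> B k p l \<noteq> 0 \<Longrightarrow> l \<in> {1..n+1}"
    by metis
  define Y where "Y = (\<lambda>(k, q). {V' \<in> gr_prod n. \<forall>u\<in>V' k.
    lin_form (n + 1) (column_form (J k) (B k) q) u = 0})"
  define I where "I = (SIGMA k:{1..n}. {1..n+1} - J k)"
  have "V' \<in> gr_prod n \<inter> \<Inter>(Y ` I) \<longleftrightarrow> V' = V" for V'
  proof
    assume V': "V' \<in> gr_prod n \<inter> \<Inter>(Y ` I)"
    have "V' k = V k" if k: "k \<in> {1..n}" for k
    proof (rule subspace_eq_of_dim_le)
      show "V' k \<subseteq> V k"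
      proof
        fix u assume u: "u \<in> V' k"
        have "u q = (\<Sum>p\<in>J k. B k p q * u p)" if q: "q \<notin> J k" for q
        proof (cases "q \<in> {1..n+1}")
          case True
          then have "V' \<in> Y (k, q)" using V' k q by (auto simp: I_def)
          then show ?thesis
            using lin_form_column_form[OF J[OF k] True q, of "B k" u] u by (auto simp: Y_def)
        next
          case False
          then have "u q = 0" using gr_prodD(2)[of V' n k] V' k u by (auto simp: coord_space_def)
          moreover have "B k p q = 0" for p using B[OF k] False by blast
          ultimately show ?thesis by simp
        qed
        then show "u \<in> V k" using V[OF k] by (simp add: graph_space_def)
      qed
    qed (use k V' assms gr_prodD in auto)
    moreover have "V' \<in> extensional {1..n}" "V \<in> extensional {1..n}"
      using V' assms by (auto simp: gr_prod_def PiE_def)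
    ultimately show "V' = V" by (intro extensionalityI) auto
  next
    assume "V' = V"
    moreover have "lin_form (n + 1) (column_form (J k) (B k) q) u = 0"
      if "k \<in> {1..n}" "q \<in> {1..n+1} - J k" "u \<in> V k" for k q u
      using that V[of k] lin_form_column_form[OF J[of k], of q "B k" u] by (simp add: graph_space_def)
    ultimately show "V' \<in> gr_prod n \<inter> \<Inter>(Y ` I)"
      using assms by (auto simp: I_def Y_def)
  qed
  then have "{V} = gr_prod n \<inter> \<Inter>(Y ` I)" by blast
  also have "zariski_closed n \<dots>"
  proof (rule zariski_closed_Inter)
    fix Z assume "Z \<in> Y ` I"
    then obtain k q where "k \<in> {1..n}" "Z = Y (k, q)" unfolding I_def by blast
    then show "zariski_closed n Z" by (simp only: Y_def prod.case zariski_closed_lin_form)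
  qed
  finally show ?thesis .
qed

section \<open>Krull dimension zero, one and at least two\<close>

lemma krull_dim_geI:
  assumes "\<And>i. i \<le> m \<Longrightarrow> closedin X (Z i) \<and> irreducible_in X (Z i)" "\<And>i. i < m \<Longrightarrow> Z i \<subset> Z (Suc i)"
  shows "enat m \<le> krull_dim X"
  unfolding krull_dim_def by (rule SUP_upper) (use assms in blast)

lemma krull_dim_leI:
  assumes "\<And>m Z. \<lbrakk>\<And>i. i \<le> m \<Longrightarrow> closedin X (Z i) \<and> irreducible_in X (Z i);
    \<And>i. i < m \<Longrightarrow> Z i \<subset> Z (Suc i)\<rbrakk> \<Longrightarrow> enat m \<le> d"
  shows "krull_dim X \<le> d"
  unfolding krull_dim_def by (rule SUP_least) (use assms in blast)

lemma krull_dim_singleton: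
  assumes "topspace X = {x}" shows "krull_dim X \<le> 0"
proof (rule krull_dim_leI)
  fix m and Z :: "nat \<Rightarrow> 'a set"
  assume Z: "\<And>i. i \<le> m \<Longrightarrow> closedin X (Z i) \<and> irreducible_in X (Z i)"
    and less: "\<And>i. i < m \<Longrightarrow> Z i \<subset> Z (Suc i)"
  show "enat m \<le> 0"
  proof (cases m)
    case (Suc m')
    then have "Z 0 \<subset> Z 1" "Z 0 \<noteq> {}" "Z 1 \<subseteq> {x}"
      using less[of 0] Z[of 0] Z[of 1] closedin_subset[of X "Z 1"] assms
      by (auto simp: irreducible_in_def)
    then show ?thesis by blast
  qed (simp add: zero_enat_def)
qed

text \<open>
  A finite irreducible set with closed points is a single point. So the middle term of a chain of length two,
  being finite, would be a point and could not properly contain another non-empty set.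
\<close>

lemma krull_dim_eq_1:
  assumes "infinite (topspace X)" "irreducible_in X (topspace X)"
    and pt: "\<And>x. x \<in> topspace X \<Longrightarrow> closedin X {x}"
    and fin: "\<And>C. \<lbrakk>closedin X C; C \<noteq> topspace X\<rbrakk> \<Longrightarrow> finite C"
  shows "krull_dim X = 1"
proof (rule antisym)
  show "krull_dim X \<le> 1"
  proof (rule krull_dim_leI)
    fix m and Z :: "nat \<Rightarrow> 'a set"
    assume Z: "\<And>i. i \<le> m \<Longrightarrow> closedin X (Z i) \<and> irreducible_in X (Z i)"
      and less: "\<And>i. i < m \<Longrightarrow> Z i \<subset> Z (Suc i)"
    show "enat m \<le> 1"
    proof (rule ccontr)
      assume "\<not> enat m \<le> 1"
      then have m: "m \<ge> 2" by (simp add: one_enat_def)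
      have c: "closedin X (Z 1)" "irreducible_in X (Z 1)" using Z[of 1] m by auto
      have "Z 0 \<subset> Z 1" using less[of 0] m by simp
      moreover have "Z 1 \<subset> Z 2" using less[of 1] m by (simp add: numeral_2_eq_2)
      moreover have "Z 2 \<subseteq> topspace X" using Z[of 2] m closedin_subset by blast
      ultimately have f: "finite (Z 1)" using fin[OF c(1)] by blast
      obtain z where z: "z \<in> Z 0" using Z[of 0] by (auto simp: irreducible_in_def)
      then have z1: "z \<in> Z 1" "z \<in> topspace X" using \<open>Z 0 \<subset> Z 1\<close> closedin_subset[OF c(1)] by auto
      have "closedin X (\<Union>((\<lambda>x. {x}) ` (Z 1 - {z})))"
        using f pt closedin_subset[OF c(1)] by (intro closedin_Union) auto
      then have "closedin X (Z 1 - {z})" by simp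
      then have "Z 1 \<subseteq> {z} \<or> Z 1 \<subseteq> Z 1 - {z}"
        using c(2) pt[OF z1(2)] unfolding irreducible_in_def by blast
      then show False using z z1 \<open>Z 0 \<subset> Z 1\<close> by blast
    qed
  qed
  obtain x where x: "x \<in> topspace X" using assms(1) by fastforce
  have "{x} \<noteq> topspace X" using assms(1) by (metis finite.emptyI finite.insertI)
  have "enat 1 \<le> krull_dim X"
  proof (rule krull_dim_geI[where Z = "\<lambda>i. if i = 0 then {x} else topspace X"])
    fix i :: nat
    show "closedin X (if i = 0 then {x} else topspace X) \<and>
        irreducible_in X (if i = 0 then {x} else topspace X)"
      using assms(2) pt[OF x] by (auto simp: irreducible_in_def)
    show "i < 1 \<Longrightarrow> (if i = 0 then {x} else topspace X) \<subset> (if Suc i = 0 then {x} else topspace X)"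
      using x \<open>{x} \<noteq> topspace X\<close> by auto
  qed
  then show "1 \<le> krull_dim X" by (simp add: one_enat_def)
qed

lemma krull_dim_ge_2:
  assumes "irreducible_in X (topspace X)" "closedin X {x}" "closedin X Z" "irreducible_in X Z"
    "{x} \<subset> Z" "Z \<subset> topspace X"
  shows "2 \<le> krull_dim X"
proof -
  have "enat 2 \<le> krull_dim X"
  proof (rule krull_dim_geI[where Z = "\<lambda>i. if i = 0 then {x} else if i = 1 then Z else topspace X"])
    fix i :: nat
    show "closedin X (if i = 0 then {x} else if i = 1 then Z else topspace X) \<and>
        irreducible_in X (if i = 0 then {x} else if i = 1 then Z else topspace X)"
      using assms by (auto simp: irreducible_in_def)
    show "i < 2 \<Longrightarrow> (if i = 0 then {x} else if i = 1 then Z else topspace X) \<subset>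
        (if Suc i = 0 then {x} else if Suc i = 1 then Z else topspace X)"
      using assms by (auto simp: less_2_cases_iff)
  qed
  then show ?thesis by (simp add: numeral_eq_enat)
qed

section \<open>The torus action in coordinates\<close>

lemma summand_index_range:
  "\<lbrakk>k \<in> {1..n}; l \<in> {1..n+1}\<rbrakk> \<Longrightarrow> summand_index n k l \<in> {1..2*n}"
  by (auto simp: summand_index_def)

lemma basis_index_summand_index:
  "\<lbrakk>k \<in> {1..n}; l \<in> {1..n+1}\<rbrakk> \<Longrightarrow> basis_index n (summand_index n k l) = l"
  by (auto simp: summand_index_def basis_index_def)

lemma inj_summand_index: "k \<in> {1..n} \<Longrightarrow> inj_on (summand_index n k) {1..n+1}"
  by (rule inj_on_inverseI[where g = "basis_index n"]) (rule basis_index_summand_index)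

lemma torus_nonzero: "\<lbrakk>t \<in> torus n; i \<in> {1..2*n}\<rbrakk> \<Longrightarrow> t i \<noteq> 0"
  by (auto simp: torus_def PiE_iff)

lemma torus_summand_nonzero:
  "\<lbrakk>t \<in> torus n; k \<in> {1..n}; l \<in> {1..n+1}\<rbrakk> \<Longrightarrow> t (summand_index n k l) \<noteq> 0"
  by (rule torus_nonzero[OF _ summand_index_range])

text \<open>
  A diagonal map scales the row of \<open>p\<close>, which has to be divided by the torus coordinate at \<open>p\<close> to restore the
  entry \<open>1\<close> at the pivot.
\<close>

lemma torus_aut_graph_space:
  assumes "t \<in> torus n" "k \<in> {1..n}" "J \<subseteq> {1..n+1}" "\<And>p l. B p l \<noteq> 0 \<Longrightarrow> l \<in> {1..n+1}"
  shows "torus_aut n t k ` graph_space J B =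
    graph_space J (\<lambda>p l. B p l * (t (summand_index n k l) / t (summand_index n k p)))"
    (is "_ = graph_space J ?C")
proof (intro antisym subsetI)
  let ?t = "\<lambda>l. t (summand_index n k l)"
  have nz: "?t l \<noteq> 0" if "l \<in> {1..n+1}" for l
    using torus_summand_nonzero[OF assms(1,2) that] .
  {
    fix v assume "v \<in> torus_aut n t k ` graph_space J B"
    then obtain u where u: "u \<in> graph_space J B" "v = torus_aut n t k u" by blast
    have "v l = (\<Sum>p\<in>J. ?C p l * v p)" if "l \<notin> J" for l
    proof -
      have "v l = (\<Sum>p\<in>J. ?t l * (B p l * u p))"
        using u that by (simp add: torus_aut_def graph_space_def sum_distrib_left)
      also have "\<dots> = (\<Sum>p\<in>J. ?C p l * v p)"
        using nz assms(3) by (intro sum.cong) (auto simp: u(2) torus_aut_def)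
      finally show ?thesis .
    qed
    then show "v \<in> graph_space J ?C" by (simp add: graph_space_def)
  next
    fix v assume v: "v \<in> graph_space J ?C"
    define u where "u = (\<lambda>l. if l \<in> {1..n+1} then v l / ?t l else 0)"
    have out: "v l = 0" if "l \<notin> {1..n+1}" for l
    proof -
      have "l \<notin> J" "\<And>p. B p l = 0" using assms(3,4) that by blast+
      then show ?thesis using v by (simp add: graph_space_def)
    qed
    have "torus_aut n t k u = v"
      using nz out by (auto simp: torus_aut_def u_def fun_eq_iff)
    moreover have "u l = (\<Sum>p\<in>J. B p l * u p)" if l: "l \<notin> J" for l
    proof (cases "l \<in> {1..n+1}")
      case True
      have "u l = (\<Sum>p\<in>J. ?C p l * v p / ?t l)"
        using True l v by (simp add: u_def graph_space_def sum_divide_distrib)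
      also have "\<dots> = (\<Sum>p\<in>J. B p l * u p)"
        using nz[OF True] assms(3) by (intro sum.cong) (auto simp: u_def)
      finally show ?thesis .
    next
      case False
      have "B p l = 0" for p using assms(4) False by blast
      then show ?thesis using False by (auto simp: u_def)
    qed
    ultimately show "v \<in> torus_aut n t k ` graph_space J B" by (force simp: graph_space_def)
  }
qed

text \<open>
  The reduced echelon forms of all components of \<open>V\<close>, at each vertex with respect to the order of the
  basis vectors by their torus weight.
\<close>

definition echelon where
  "echelon n V J B \<longleftrightarrow> (\<forall>k\<in>{1..n}. J k \<subseteq> {1..n+1} \<and> card (J k) = k \<and>
     V k = graph_space (J k) (B k) \<and>
     (\<forall>p l. B k p l \<noteq> 0 \<longrightarrow> p \<in> J k \<and> l \<in> {1..n+1} - J k \<and>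
        summand_index n k p < summand_index n k l))"

lemma echelonD:
  assumes "echelon n V J B" "k \<in> {1..n}"
  shows "J k \<subseteq> {1..n+1}" "finite (J k)" "card (J k) = k" "V k = graph_space (J k) (B k)"
    "\<And>p l. B k p l \<noteq> 0 \<Longrightarrow> p \<in> J k" "\<And>p l. B k p l \<noteq> 0 \<Longrightarrow> l \<in> {1..n+1}"
    "\<And>p l. B k p l \<noteq> 0 \<Longrightarrow> l \<notin> J k"
    "\<And>p l. B k p l \<noteq> 0 \<Longrightarrow> summand_index n k p < summand_index n k l"
proof -
  note * = assms(1)[unfolded echelon_def, THEN bspec, OF assms(2)]
  then show J: "J k \<subseteq> {1..n+1}" by (rule conjunct1)
  show "finite (J k)" by (rule finite_subset[OF J]) simp
  show "card (J k) = k" "V k = graph_space (J k) (B k)" using * by simp_all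
  fix p l assume "B k p l \<noteq> 0"
  with * have "p \<in> J k \<and> l \<in> {1..n+1} - J k \<and> summand_index n k p < summand_index n k l" by metis
  then show "p \<in> J k" "l \<in> {1..n+1}" "l \<notin> J k" "summand_index n k p < summand_index n k l"
    by simp_all
qed

lemma echelon_exists:
  assumes "V \<in> gr_prod n" shows "\<exists>J B. echelon n V J B"
proof -
  let ?P = "\<lambda>k J B. J \<subseteq> {1..n+1} \<and> card J = k \<and> V k = graph_space J B \<and>
     (\<forall>p l. B p l \<noteq> 0 \<longrightarrow> p \<in> J \<and> l \<in> {1..n+1} - J \<and>
        summand_index n k p < summand_index n k l)"
  have "\<exists>z. ?P k (fst z) (snd z)" if k: "k \<in> {1..n}" for k
  proof -
    obtain J B where "?P k J B"
      using gr_prod_echelon[OF assms k inj_summand_index[OF k]] by blast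
    then show ?thesis by (intro exI[of _ "(J, B)"]) simp
  qed
  then have "\<forall>k\<in>{1..n}. \<exists>z. ?P k (fst z) (snd z)" by blast
  from bchoice[OF this] obtain z where z: "\<forall>k\<in>{1..n}. ?P k (fst (z k)) (snd (z k))" ..
  then have "echelon n V (\<lambda>k. fst (z k)) (\<lambda>k. snd (z k))" unfolding echelon_def .
  then show ?thesis by blast
qed

lemma act_apply: "k \<in> {1..n} \<Longrightarrow> act n g V k = g k ` V k"
  by (simp add: act_def)

lemma act_torus_echelon:
  assumes "echelon n V J B" "t \<in> torus n" "k \<in> {1..n}"
  shows "act n (torus_aut n t) V k = graph_space (J k)
    (\<lambda>p l. B k p l * (t (summand_index n k l) / t (summand_index n k p)))"
  unfolding act_apply[OF assms(3)] echelonD(4)[OF assms(1,3)]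
  by (rule torus_aut_graph_space[OF assms(2,3) echelonD(1,6)[OF assms(1,3)]])

lemma gr_prodI:
  assumes "V \<in> extensional {1..n}"
    "\<And>k. k \<in> {1..n} \<Longrightarrow> J k \<subseteq> {1..n+1} \<and> card (J k) = k \<and> V k = graph_space (J k) (B k)"
    "\<And>k p l. k \<in> {1..n} \<Longrightarrow> B k p l \<noteq> 0 \<Longrightarrow> l \<in> {1..n+1}"
  shows "V \<in> gr_prod n"
  unfolding gr_prod_def
proof (intro PiE_I)
  fix k assume k: "k \<in> {1..n}"
  then have "finite (J k)" using assms(2) finite_subset by blast
  moreover have "V k \<subseteq> W n"
    using graph_space_subset_coord_space[of "J k" "n + 1" "B k"] assms(2,3)[OF k] by metis
  ultimately show "V k \<in> {V. cvec.subspace V \<and> V \<subseteq> W n \<and> cvec.dim V = k}"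
    using assms(2)[OF k] dim_graph_space[of "J k" "B k"] subspace_graph_space[of "J k" "B k"]
    by simp
qed (use assms(1) in \<open>auto simp: extensional_def\<close>)

lemma act_torus_gr_prod:
  assumes "V \<in> gr_prod n" "t \<in> torus n"
  shows "act n (torus_aut n t) V \<in> gr_prod n"
proof -
  obtain J B where JB: "echelon n V J B" using echelon_exists[OF assms(1)] by blast
  show ?thesis
  proof (rule gr_prodI)
    fix k assume k: "k \<in> {1..n}"
    show "J k \<subseteq> {1..n+1} \<and> card (J k) = k \<and> act n (torus_aut n t) V k = graph_space (J k)
        (\<lambda>p l. B k p l * (t (summand_index n k l) / t (summand_index n k p)))"
      using echelonD(1,3)[OF JB k] act_torus_echelon[OF JB assms(2) k] by blast
    fix p l assume "B k p l * (t (summand_index n k l) / t (summand_index n k p)) \<noteq> 0"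
    then show "l \<in> {1..n+1}" using echelonD(6)[OF JB k, of p l] by force
  qed (simp add: act_def)
qed

text \<open>
  The entry at \<open>(p, l)\<close> is the \<open>l\<close>-th coordinate of the unique vector of the space that restricts to the
  \<open>p\<close>-th unit vector on \<open>J\<close>, so the space determines the matrix.
\<close>

lemma graph_space_inj:
  assumes "graph_space J B = graph_space J C" "finite J" "p \<in> J" "l \<notin> J"
  shows "B p l = C p l"
proof -
  have "graph_vec J B p \<in> graph_space J C" using graph_vec_in[OF assms(2,3), of B] assms(1) by simp
  then have "graph_vec J B p l = (\<Sum>q\<in>J. C q l * graph_vec J B p q)"
    using assms(4) by (simp add: graph_space_def)
  also have "\<dots> = (\<Sum>q\<in>J. if q = p then C q l else 0)"
    by (intro sum.cong) (auto simp: graph_vec_def)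
  finally show ?thesis using assms by (simp add: graph_vec_def)
qed

text \<open>
  The pairs of weights \<open>(x, y)\<close> for which the character \<open>t y / t x\<close> acts on some non-zero entry of the
  echelon forms.
\<close>

definition weight_pairs :: "nat \<Rightarrow> (nat \<Rightarrow> nat \<Rightarrow> nat \<Rightarrow> complex) \<Rightarrow> (nat \<times> nat) set" where
  "weight_pairs n B =
    {(summand_index n k p, summand_index n k l) | k p l. k \<in> {1..n} \<and> B k p l \<noteq> 0}"

lemma weight_pairsI:
  "\<lbrakk>k \<in> {1..n}; B k p l \<noteq> 0\<rbrakk> \<Longrightarrow> (summand_index n k p, summand_index n k l) \<in> weight_pairs n B"
  unfolding weight_pairs_def by blast

lemma weight_pairs_range:
  assumes "echelon n V J B" "(x, y) \<in> weight_pairs n B"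
  shows "x < y" "x \<in> {1..2*n}" "y \<in> {1..2*n}"
proof -
  obtain k p l where k: "k \<in> {1..n}" "B k p l \<noteq> 0" "x = summand_index n k p" "y = summand_index n k l"
    using assms(2) by (auto simp: weight_pairs_def)
  show "x < y" using echelonD(8)[OF assms(1) k(1,2)] k(3,4) by simp
  have "p \<in> {1..n+1}" using echelonD(1)[OF assms(1) k(1)] echelonD(5)[OF assms(1) k(1,2)] by blast
  then show "x \<in> {1..2*n}" using summand_index_range[OF k(1)] k(3) by simp
  show "y \<in> {1..2*n}"
    using summand_index_range[OF k(1) echelonD(6)[OF assms(1) k(1,2)]] k(4) by simp
qed

text \<open>
  An echelon form is unique, so a translate of \<open>V\<close> is equal to \<open>V\<close> iff all the characters that scale its non-zero
  entries are trivial.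
\<close>

lemma act_torus_fixes_iff:
  assumes "echelon n V J B" "t \<in> torus n" "V \<in> extensional {1..n}"
  shows "act n (torus_aut n t) V = V \<longleftrightarrow> (\<forall>(x, y)\<in>weight_pairs n B. t x = t y)"
proof
  assume fixed: "act n (torus_aut n t) V = V"
  have "t (summand_index n k p) = t (summand_index n k l)" if k: "k \<in> {1..n}" and Bk: "B k p l \<noteq> 0" for k p l
  proof -
    have "graph_space (J k) (\<lambda>p l. B k p l * (t (summand_index n k l) / t (summand_index n k p)))
        = graph_space (J k) (B k)"
      using act_torus_echelon[OF assms(1,2) k] echelonD(4)[OF assms(1) k] fixed by simp
    from graph_space_inj[OF this echelonD(2,5)[OF assms(1) k] echelonD(7)[OF assms(1) k], OF Bk Bk]
    have "t (summand_index n k l) / t (summand_index n k p) = 1"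
      using Bk by (metis mult_cancel_left2)
    then show ?thesis by (metis divide_eq_1_iff)
  qed
  then show "\<forall>(x, y)\<in>weight_pairs n B. t x = t y" by (auto simp: weight_pairs_def)
next
  assume eq: "\<forall>(x, y)\<in>weight_pairs n B. t x = t y"
  have "act n (torus_aut n t) V k = V k" if k: "k \<in> {1..n}" for k
  proof -
    note * = echelonD[OF assms(1) k]
    have "B k p l * (t (summand_index n k l) / t (summand_index n k p)) = B k p l" for p l
    proof (cases "B k p l = 0")
      case False
      then have "t (summand_index n k p) = t (summand_index n k l)"
        using bspec[OF eq weight_pairsI[of k n B p l, OF k False]] by simp
      moreover have "t (summand_index n k l) \<noteq> 0"
        by (rule torus_summand_nonzero[OF assms(2) k *(6)[OF False]])
      ultimately show ?thesis by simp
    qed simp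
    then show ?thesis using act_torus_echelon[OF assms(1,2) k] *(4) by simp
  qed
  then show "act n (torus_aut n t) V = V"
    using assms(3) by (intro extensionalityI[of _ "{1..n}"]) (auto simp: act_def)
qed

section \<open>Orbits of subtori\<close>

lemma frames_exist:
  assumes "V \<in> gr_prod n" shows "\<exists>A. A \<in> frames_of n V"
proof -
  obtain J B where JB: "echelon n V J B" using echelon_exists[OF assms] by blast
  have "\<exists>e. bij_betw e {1..k} (J k)" if "k \<in> {1..n}" for k
    using ex_bij_betw_nat_finite_1[OF echelonD(2)[OF JB that]] echelonD(3)[OF JB that] by simp
  then obtain e where e: "\<And>k. k \<in> {1..n} \<Longrightarrow> bij_betw (e k) {1..k} (J k)" by metis
  have "cvec.span ((\<lambda>l. graph_vec (J k) (B k) (e k l)) ` {1..k}) = V k" if k: "k \<in> {1..n}" for k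
  proof -
    have "(\<lambda>l. graph_vec (J k) (B k) (e k l)) ` {1..k} = graph_vec (J k) (B k) ` J k"
      using bij_betw_imp_surj_on[OF e[OF k]] by (metis image_image)
    then show ?thesis using span_graph_vec[OF echelonD(2)[OF JB k]] echelonD(4)[OF JB k] by simp
  qed
  then have "(\<lambda>k l. graph_vec (J k) (B k) (e k l)) \<in> frames_of n V" by (simp add: frames_of_def)
  then show ?thesis by blast
qed

lemma frames_of_act:
  assumes "A \<in> frames_of n V"
    "\<And>k x y. g k (x + y) = g k x + g k y" "\<And>k c x. g k (cscale c x) = cscale c (g k x)"
  shows "(\<lambda>k l. g k (A k l)) \<in> frames_of n (act n g V)"
proof -
  have "cvec.span ((\<lambda>l. g k (A k l)) ` {1..k}) = g k ` V k" if "k \<in> {1..n}" for k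
    using span_image_linear[of "g k" "A k ` {1..k}", OF assms(2,3)] frames_of_span[OF assms(1) that]
    by (simp add: image_image)
  then show ?thesis by (simp add: frames_of_def act_apply)
qed

lemma torus_aut_linear:
  "torus_aut n t k (x + y) = torus_aut n t k x + torus_aut n t k y"
  "torus_aut n t k (cscale c x) = cscale c (torus_aut n t k x)"
  by (auto simp: torus_aut_def fun_eq_iff ring_distribs)

definition subtorus :: "nat \<Rightarrow> (nat \<times> nat) set \<Rightarrow> (nat \<Rightarrow> complex) set" where
  "subtorus n E = {t \<in> torus n. \<forall>(x, y)\<in>E. t x = t y}"

lemma subtorus_eq: "\<lbrakk>t \<in> subtorus n E; (x, y) \<in> E\<rbrakk> \<Longrightarrow> t x = t y"
  by (auto simp: subtorus_def)

lemma one_in_subtorus: "E \<subseteq> {1..2*n} \<times> {1..2*n} \<Longrightarrow> (\<lambda>i\<in>{1..2*n}. 1) \<in> subtorus n E"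
  by (auto simp: subtorus_def torus_def)

text \<open>
  A subtorus given by equations between coordinates is a linear space minus coordinate hyperplanes. Hence
  the line through two of its points meets its complement in finitely many points, and frames of
  \<open>V\<close> translated along the line are polynomial in the parameter.
\<close>

lemma irreducible_subtorus_orbit:
  assumes V: "V \<in> gr_prod n" and E: "E \<subseteq> {1..2*n} \<times> {1..2*n}"
    and L: "(\<lambda>t. act n (torus_aut n t) V) ` subtorus n E \<subseteq> L" "L \<subseteq> gr_prod n"
  shows "irreducible_in (subtopology (zariski n) L) ((\<lambda>t. act n (torus_aut n t) V) ` subtorus n E)"
proof (rule irreducible_by_curves)
  show "(\<lambda>t. act n (torus_aut n t) V) ` subtorus n E \<noteq> {}" using one_in_subtorus[OF E] by blast
  fix V0 V1
  assume "V0 \<in> (\<lambda>t. act n (torus_aut n t) V) ` subtorus n E"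
    "V1 \<in> (\<lambda>t. act n (torus_aut n t) V) ` subtorus n E"
  then obtain t0 t1 where t0: "t0 \<in> subtorus n E" "V0 = act n (torus_aut n t0) V"
    and t1: "t1 \<in> subtorus n E" "V1 = act n (torus_aut n t1) V" by blast
  obtain A where A: "A \<in> frames_of n V" using frames_exist[OF V] by blast
  define t where "t = (\<lambda>s. \<lambda>i\<in>{1..2*n}. t0 i + s * (t1 i - t0 i))"
  define A' where "A' = (\<lambda>s k l. torus_aut n (t s) k (A k l))"
  have fr: "A' s \<in> frames_of n (act n (torus_aut n (t s)) V)" for s
    unfolding A'_def by (rule frames_of_act[OF A]) (rule torus_aut_linear)+
  have "t0 \<in> extensional {1..2*n}" "t1 \<in> extensional {1..2*n}"
    using t0(1) t1(1) by (auto simp: subtorus_def torus_def PiE_def)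
  then have ends: "t 0 = t0" "t 1 = t1"
    by (auto simp: t_def fun_eq_iff extensional_def)
  have poly: "\<exists>p. \<forall>s. A' s k l i = poly p s" for k l i
  proof -
    let ?x = "summand_index n k i"
    \<comment> \<open>Weights outside \<open>{1..2*n}\<close> belong to irrelevant vertices and coordinates; there \<open>t s\<close> is constant.\<close>
    have "A' s k l i = poly (smult (A k l i) (if ?x \<in> {1..2*n} then [:t0 ?x, t1 ?x - t0 ?x:]
        else [:undefined:])) s" for s
      by (simp add: A'_def torus_aut_def t_def algebra_simps)
    then show ?thesis by blast
  qed
  have "finite {s. \<not> (\<exists>V'\<in>(\<lambda>t. act n (torus_aut n t) V) ` subtorus n E. A' s \<in> frames_of n V')}"
  proof (rule finite_subset)
    show "{s. \<not> (\<exists>V'\<in>(\<lambda>t. act n (torus_aut n t) V) ` subtorus n E. A' s \<in> frames_of n V')} \<subseteq>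
      (\<Union>i\<in>{1..2*n}. {s. poly [:t0 i, t1 i - t0 i:] s = 0})"
    proof (rule ccontr)
      assume "\<not> ?thesis"
      then obtain s where
        s: "\<not> (\<exists>V'\<in>(\<lambda>t. act n (torus_aut n t) V) ` subtorus n E. A' s \<in> frames_of n V')"
        and nz: "\<forall>i\<in>{1..2*n}. t0 i + s * (t1 i - t0 i) \<noteq> 0" by auto
      have "t s \<in> torus n" using nz by (auto simp: torus_def t_def)
      moreover have "t s x = t s y" if "(x, y) \<in> E" for x y
        using that E subtorus_eq[OF t0(1) that] subtorus_eq[OF t1(1) that] by (auto simp: t_def)
      ultimately have "t s \<in> subtorus n E" by (auto simp: subtorus_def)
      then show False using s fr[of s] by blast
    qed
    have "[:t0 i, t1 i - t0 i:] \<noteq> 0" if "i \<in> {1..2*n}" for i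
      using torus_nonzero[OF _ that, of t0] t0(1) by (auto simp: subtorus_def)
    then show "finite (\<Union>i\<in>{1..2*n}. {s. poly [:t0 i, t1 i - t0 i:] s = 0})"
      by (intro finite_UN_I poly_roots_finite) auto
  qed
  then show "\<exists>A s0 s1. (\<forall>k l i. \<exists>p. \<forall>s. A s k l i = poly p s) \<and>
      A s0 \<in> frames_of n V0 \<and> A s1 \<in> frames_of n V1 \<and>
      finite {s. \<not> (\<exists>V\<in>(\<lambda>t. act n (torus_aut n t) V) ` subtorus n E. A s \<in> frames_of n V)}"
    using poly fr[of 0] fr[of 1] ends t0(2) t1(2)
    by (intro exI[of _ A'] exI[of _ 0] exI[of _ 1]) auto
qed (use L in auto)

lemma topspace_zariski: "topspace (zariski n) = gr_prod n"
proof (rule antisym)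
  have "zariski_closed n (topspace (zariski n))" by (simp flip: closedin_zariski)
  then show "topspace (zariski n) \<subseteq> gr_prod n" by (simp add: zariski_closed_def)
  have "zariski_closed n (gr_prod n)" by (auto simp: zariski_closed_def intro: exI[of _ "{}"])
  then have "closedin (zariski n) (gr_prod n)" by (simp only: closedin_zariski)
  then show "gr_prod n \<subseteq> topspace (zariski n)" by (rule closedin_subset)
qed

lemma torus_orbit_subset_gr_prod: "V \<in> gr_prod n \<Longrightarrow> torus_orbit n V \<subseteq> gr_prod n"
  by (auto simp: torus_orbit_def act_torus_gr_prod)

text \<open>
  The chain is the point \<open>V\<close>, the orbit of the subtorus, and the orbit of the whole torus.
\<close>

lemma krull_dim_torus_orbit_ge_2:
  assumes V: "V \<in> gr_prod n" and E: "E \<subseteq> {1..2*n} \<times> {1..2*n}" and Y: "zariski_closed n Y"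
    and iff: "\<And>t. t \<in> torus n \<Longrightarrow> act n (torus_aut n t) V \<in> Y \<longleftrightarrow> t \<in> subtorus n E"
    and t1: "t1 \<in> subtorus n E" "act n (torus_aut n t1) V \<noteq> V"
    and t2: "t2 \<in> torus n" "t2 \<notin> subtorus n E"
  shows "2 \<le> krull_dim (subtopology (zariski n) (torus_orbit n V))"
proof -
  let ?L = "torus_orbit n V" and ?Z = "(\<lambda>t. act n (torus_aut n t) V) ` subtorus n E"
  have L: "?L \<subseteq> gr_prod n" by (rule torus_orbit_subset_gr_prod[OF V])
  have top: "topspace (subtopology (zariski n) ?L) = ?L" using L by (auto simp: topspace_zariski)
  have ext: "V \<in> extensional {1..n}" using V by (simp add: gr_prod_def PiE_def)
  have one: "act n (torus_aut n (\<lambda>i\<in>{1..2*n}. 1)) V = V"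
  proof -
    obtain J B where "echelon n V J B" using echelon_exists[OF V] by blast
    then show ?thesis using weight_pairs_range one_in_subtorus[of "{}" n] ext
      by (subst act_torus_fixes_iff) (auto simp: subtorus_def)
  qed
  have sub: "subtorus n E \<subseteq> torus n" by (auto simp: subtorus_def)
  have Z: "?Z = Y \<inter> ?L" using iff sub by (auto simp: torus_orbit_def)
  have VZ: "V \<in> ?Z" using one one_in_subtorus[OF E] by (metis image_eqI)
  have irr: "irreducible_in (subtopology (zariski n) ?L) ?L"
    using irreducible_subtorus_orbit[OF V, of "{}" ?L] L by (auto simp: torus_orbit_def subtorus_def)
  show ?thesis
  proof (rule krull_dim_ge_2)
    show "irreducible_in (subtopology (zariski n) ?L) (topspace (subtopology (zariski n) ?L))"
      using irr by (simp only: top)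
    show "closedin (subtopology (zariski n) ?L) {V}"
      using zariski_closed_point[OF V] VZ Z by (auto simp: closedin_subtopology closedin_zariski)
    show "closedin (subtopology (zariski n) ?L) ?Z"
      using Y Z by (auto simp: closedin_subtopology closedin_zariski)
    show "irreducible_in (subtopology (zariski n) ?L) ?Z"
      by (rule irreducible_subtorus_orbit[OF V E]) (use Z L in auto)
    show "{V} \<subset> ?Z" using VZ t1 by blast
    show "?Z \<subset> topspace (subtopology (zariski n) ?L)"
      unfolding top using Z iff[OF t2(1)] t2 by (auto simp: torus_orbit_def)
  qed
qed

section \<open>Orbits of dimension at least two\<close>

lemma sum_mult_graph_vec:
  assumes "finite J" "r \<in> J"
  shows "(\<Sum>p\<in>J. a p * graph_vec J B r p) = a r"
proof -
  have "(\<Sum>p\<in>J. a p * graph_vec J B r p) = (\<Sum>p\<in>J. if p = r then a p else 0)"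
    by (intro sum.cong) (auto simp: graph_vec_def)
  then show ?thesis using assms by simp
qed

lemma graph_space_sum_vanishes_iff:
  assumes "finite J"
  shows "(\<forall>v\<in>graph_space J B. (\<Sum>p\<in>J. a p * v p) = 0) \<longleftrightarrow> (\<forall>p\<in>J. a p = 0)"
proof
  assume L: "\<forall>v\<in>graph_space J B. (\<Sum>p\<in>J. a p * v p) = 0"
  show "\<forall>p\<in>J. a p = 0"
  proof
    fix p assume p: "p \<in> J"
    then show "a p = 0"
      using bspec[OF L graph_vec_in[OF assms p]] by (simp add: sum_mult_graph_vec[OF assms p])
  qed
qed simp

lemma graph_space_sum_proportional_iff:
  assumes "finite J" "r \<in> J"
  shows "(\<forall>u\<in>graph_space J B. \<forall>v\<in>graph_space J B.
      (\<Sum>p\<in>J. a p * u p) * v r = (\<Sum>p\<in>J. a p * v p) * u r) \<longleftrightarrow> (\<forall>p\<in>J - {r}. a p = 0)"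
proof
  assume L: "\<forall>u\<in>graph_space J B. \<forall>v\<in>graph_space J B.
      (\<Sum>p\<in>J. a p * u p) * v r = (\<Sum>p\<in>J. a p * v p) * u r"
  show "\<forall>p\<in>J - {r}. a p = 0"
  proof
    fix p assume p: "p \<in> J - {r}"
    then have pJ: "p \<in> J" by simp
    have "(\<Sum>q\<in>J. a q * graph_vec J B p q) * graph_vec J B r r =
        (\<Sum>q\<in>J. a q * graph_vec J B r q) * graph_vec J B p r"
      by (rule L[THEN bspec, THEN bspec, OF graph_vec_in[OF assms(1) pJ] graph_vec_in[OF assms]])
    then show "a p = 0"
      unfolding sum_mult_graph_vec[OF assms(1) pJ] sum_mult_graph_vec[OF assms]
      using p assms(2) by (simp add: graph_vec_def split: if_splits)
  qed
next
  assume R: "\<forall>p\<in>J - {r}. a p = 0"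
  have "(\<Sum>p\<in>J. a p * u p) = a r * u r" for u :: cvec
  proof -
    have "(\<Sum>p\<in>J. a p * u p) = (\<Sum>p\<in>{r}. a p * u p)"
      by (intro sum.mono_neutral_right) (use assms R in auto)
    then show ?thesis by simp
  qed
  then show "\<forall>u\<in>graph_space J B. \<forall>v\<in>graph_space J B.
      (\<Sum>p\<in>J. a p * u p) * v r = (\<Sum>p\<in>J. a p * v p) * u r" by (simp add: mult.commute mult.left_commute)
qed

lemma lin_form_coordinate:
  assumes "r \<in> {1..m}" shows "lin_form m (\<lambda>x. if x = r then 1 else 0) u = u r"
proof -
  have "lin_form m (\<lambda>x. if x = r then 1 else 0) u = (\<Sum>x\<in>{1..m}. if x = r then u x else 0)"
    unfolding lin_form_def by (intro sum.cong) auto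
  then show ?thesis using assms by simp
qed

text \<open>
  On the translate by \<open>t\<close> the form of column \<open>q\<close> has a coefficient at \<open>p\<close> that vanishes iff the entry at
  \<open>(p, q)\<close> is zero or is fixed by \<open>t\<close>.
\<close>

lemma column_form_on_translate:
  assumes "echelon n V J B" "t \<in> torus n" "k \<in> {1..n}" "q \<in> {1..n+1}" "q \<notin> J k"
    "v \<in> act n (torus_aut n t) V k"
  shows "lin_form (n + 1) (column_form (J k) (B k) q) v =
    (\<Sum>p\<in>J k. (B k p q * (t (summand_index n k q) / t (summand_index n k p) - 1)) * v p)"
proof -
  have "v q = (\<Sum>p\<in>J k. B k p q * (t (summand_index n k q) / t (summand_index n k p)) * v p)"
    using assms(5,6) act_torus_echelon[OF assms(1-3)] by (simp add: graph_space_def)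
  then show ?thesis
    using lin_form_column_form[OF echelonD(1)[OF assms(1,3)] assms(4,5), of "B k" v]
    by (simp add: sum_subtractf ring_distribs)
qed

definition column_pairs where
  "column_pairs n B k q P =
    (\<lambda>p. (summand_index n k p, summand_index n k q)) ` {p \<in> P. B k p q \<noteq> 0}"

lemma column_pairs_subtorus_iff:
  assumes "echelon n V J B" "t \<in> torus n" "k \<in> {1..n}" "q \<in> {1..n+1}" "P \<subseteq> J k"
  shows "t \<in> subtorus n (column_pairs n B k q P) \<longleftrightarrow>
    (\<forall>p\<in>P. B k p q * (t (summand_index n k q) / t (summand_index n k p) - 1) = 0)"
proof -
  have "B k p q * (t (summand_index n k q) / t (summand_index n k p) - 1) = 0 \<longleftrightarrow>
      (B k p q \<noteq> 0 \<longrightarrow> t (summand_index n k p) = t (summand_index n k q))" if "p \<in> P" for p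
  proof -
    have "p \<in> {1..n+1}" using that assms(5) echelonD(1)[OF assms(1,3)] by blast
    then have "t (summand_index n k p) \<noteq> 0" by (rule torus_summand_nonzero[OF assms(2,3)])
    then show ?thesis by auto
  qed
  then have "(\<forall>p\<in>P. B k p q * (t (summand_index n k q) / t (summand_index n k p) - 1) = 0) \<longleftrightarrow>
      (\<forall>p\<in>P. B k p q \<noteq> 0 \<longrightarrow> t (summand_index n k p) = t (summand_index n k q))" by simp
  then show ?thesis using assms(2) unfolding subtorus_def column_pairs_def by auto
qed

text \<open>
  Take one of the two weight pairs, from the entry at row \<open>p\<close> and column \<open>q\<close> at vertex \<open>k\<close>. A proper closed
  subset of the orbit with more than one point is needed. If \<open>p\<close> is the only non-zero row of the column, the
  vanishing of the column form amounts to the equality of the torus coordinates at the two weights of this pair,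
  and the subtorus given by it still moves the other pair. If there is
  another non-zero row \<open>r\<close>, requiring the column form to be proportional to the coordinate \<open>r\<close> fixes all
  entries of the column but the one in row \<open>r\<close>, which can still be moved.
\<close>

lemma two_weight_pairs_krull_dim:
  assumes V: "V \<in> gr_prod n" and ech: "echelon n V J B"
    and e: "e \<in> weight_pairs n B" "e' \<in> weight_pairs n B" "e \<noteq> e'"
  shows "2 \<le> krull_dim (subtopology (zariski n) (torus_orbit n V))"
proof -
  obtain k p q where k: "k \<in> {1..n}" and Bpq: "B k p q \<noteq> 0"
    and e_eq: "e = (summand_index n k p, summand_index n k q)"
    using e(1) unfolding weight_pairs_def by blast
  note D = echelonD[OF ech k]
  have pJ: "p \<in> J k" and q: "q \<in> {1..n+1}" "q \<notin> J k" using D(5,6,7) Bpq by blast+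
  have ext: "V \<in> extensional {1..n}" using V by (simp add: gr_prod_def PiE_def)
  \<comment> \<open>\<open>tw z\<close> separates the weight \<open>z\<close> from all others.\<close>
  define tw where "tw = (\<lambda>z. \<lambda>i\<in>{1..2*n}. if i = z then 2 else (1::complex))"
  have tw: "tw z \<in> torus n" for z by (auto simp: tw_def torus_def)
  have sq: "summand_index n k q \<in> {1..2*n}" by (rule summand_index_range[OF k q(1)])
  have sp: "summand_index n k p' \<in> {1..2*n}" if "p' \<in> J k" for p'
    using summand_index_range[OF k] D(1) that by blast
  have range: "column_pairs n B k q P \<subseteq> {1..2*n} \<times> {1..2*n}" if "P \<subseteq> J k" for P
    using sp sq that by (auto simp: column_pairs_def)
  have lt: "summand_index n k p' < summand_index n k q" if "B k p' q \<noteq> 0" for p'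
    using D(8)[OF that] .
  have move: "act n (torus_aut n t) V \<noteq> V" if "t \<in> torus n" "(x, y) \<in> weight_pairs n B" "t x \<noteq> t y" for t x y
    using act_torus_fixes_iff[OF ech that(1) ext] that(2,3) by auto
  show ?thesis
  proof (cases "\<exists>r\<in>J k. r \<noteq> p \<and> B k r q \<noteq> 0")
    case False
    define Y where "Y = {V' \<in> gr_prod n. \<forall>u\<in>V' k. lin_form (n + 1) (column_form (J k) (B k) q) u = 0}"
    obtain x' y' where e': "e' = (x', y')" by (cases e')
    note r' = weight_pairs_range[OF ech e(2)[unfolded e']]
    \<comment> \<open>Both pairs are increasing and they differ, so \<open>e'\<close> has a weight that \<open>e\<close> does not have.\<close>
    obtain z where z: "z = x' \<and> z \<noteq> y' \<or> z = y' \<and> z \<noteq> x'"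
        "z \<noteq> summand_index n k p" "z \<noteq> summand_index n k q"
      using e(3) r'(1) lt[OF Bpq] unfolding e_eq e' by (metis less_asym nat_neq_iff)
    show ?thesis
    proof (rule krull_dim_torus_orbit_ge_2[OF V range[OF subset_refl]])
      show "zariski_closed n Y" unfolding Y_def by (rule zariski_closed_lin_form[OF k])
      fix t assume t: "t \<in> torus n"
      have "act n (torus_aut n t) V \<in> Y \<longleftrightarrow> (\<forall>v\<in>act n (torus_aut n t) V k.
          (\<Sum>p\<in>J k. (B k p q * (t (summand_index n k q) / t (summand_index n k p) - 1)) * v p) = 0)"
        unfolding Y_def using act_torus_gr_prod[OF V t] column_form_on_translate[OF ech t k q]
        by (simp cong: ball_cong)
      also have "\<dots> \<longleftrightarrow> t \<in> subtorus n (column_pairs n B k q (J k))"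
        unfolding act_torus_echelon[OF ech t k] graph_space_sum_vanishes_iff[OF D(2)]
          column_pairs_subtorus_iff[OF ech t k q(1) subset_refl] ..
      finally show "act n (torus_aut n t) V \<in> Y \<longleftrightarrow> t \<in> subtorus n (column_pairs n B k q (J k))" .
    next
      have "{p \<in> J k. B k p q \<noteq> 0} = {p}" using False pJ Bpq by blast
      then show "tw z \<in> subtorus n (column_pairs n B k q (J k))"
        using tw z(2,3) sp[OF pJ] sq by (simp add: subtorus_def column_pairs_def tw_def)
      have "tw z x' \<noteq> tw z y'" using r' z(1) by (auto simp: tw_def)
      then show "act n (torus_aut n (tw z)) V \<noteq> V" by (rule move[OF tw e(2)[unfolded e']])
    next
      have "tw (summand_index n k p) (summand_index n k p) \<noteq> tw (summand_index n k p) (summand_index n k q)"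
        using lt[OF Bpq] sp[OF pJ] sq by (simp add: tw_def)
      then show "tw (summand_index n k p) \<notin> subtorus n (column_pairs n B k q (J k))"
        using subtorus_eq pJ Bpq unfolding column_pairs_def by blast
    qed (rule tw)
  next
    case True
    then obtain r where r: "r \<in> J k" "r \<noteq> p" "B k r q \<noteq> 0" by blast
    have rn: "r \<in> {1..n+1}" using r(1) D(1) by blast
    define Y where "Y = {V' \<in> gr_prod n. \<forall>u\<in>V' k. \<forall>v\<in>V' k.
      lin_form (n + 1) (column_form (J k) (B k) q) u * lin_form (n + 1) (\<lambda>x. if x = r then 1 else 0) v =
      lin_form (n + 1) (column_form (J k) (B k) q) v * lin_form (n + 1) (\<lambda>x. if x = r then 1 else 0) u}"
    have inj: "summand_index n k p' \<noteq> summand_index n k r" if "p' \<in> J k" "p' \<noteq> r" for p'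
      using inj_onD[OF inj_summand_index[OF k], of p' r] that D(1) rn by blast
    have sub: "J k - {r} \<subseteq> J k" by blast
    show ?thesis
    proof (rule krull_dim_torus_orbit_ge_2[OF V range[OF sub]])
      show "zariski_closed n Y" unfolding Y_def by (rule zariski_closed_proportional_forms[OF k])
      fix t assume t: "t \<in> torus n"
      have "act n (torus_aut n t) V \<in> Y \<longleftrightarrow>
        (\<forall>u\<in>act n (torus_aut n t) V k. \<forall>v\<in>act n (torus_aut n t) V k.
          (\<Sum>p\<in>J k. (B k p q * (t (summand_index n k q) / t (summand_index n k p) - 1)) * u p) * v r =
          (\<Sum>p\<in>J k. (B k p q * (t (summand_index n k q) / t (summand_index n k p) - 1)) * v p) * u r)"
        unfolding Y_def lin_form_coordinate[OF rn]
        using act_torus_gr_prod[OF V t] column_form_on_translate[OF ech t k q]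
        by (simp cong: ball_cong)
      also have "\<dots> \<longleftrightarrow> t \<in> subtorus n (column_pairs n B k q (J k - {r}))"
        unfolding act_torus_echelon[OF ech t k] graph_space_sum_proportional_iff[OF D(2) r(1)]
          column_pairs_subtorus_iff[OF ech t k q(1) sub] ..
      finally show "act n (torus_aut n t) V \<in> Y \<longleftrightarrow> t \<in> subtorus n (column_pairs n B k q (J k - {r}))" .
    next
      have "tw (summand_index n k r) (summand_index n k p') = tw (summand_index n k r) (summand_index n k q)"
        if "p' \<in> J k - {r}" for p'
        using that inj[of p'] lt[OF r(3)] sp[of p'] sq by (simp add: tw_def)
      then show "tw (summand_index n k r) \<in> subtorus n (column_pairs n B k q (J k - {r}))"
        using tw by (simp add: subtorus_def column_pairs_def)
      have "tw (summand_index n k r) (summand_index n k r) \<noteq> tw (summand_index n k r) (summand_index n k q)"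
        using lt[OF r(3)] sp[OF r(1)] sq by (simp add: tw_def)
      then show "act n (torus_aut n (tw (summand_index n k r))) V \<noteq> V"
        by (rule move[OF tw weight_pairsI[of k n B r q, OF k r(3)]])
    next
      have "tw (summand_index n k p) (summand_index n k p) \<noteq> tw (summand_index n k p) (summand_index n k q)"
        using lt[OF Bpq] sp[OF pJ] sq by (simp add: tw_def)
      then show "tw (summand_index n k p) \<notin> subtorus n (column_pairs n B k q (J k - {r}))"
        using subtorus_eq pJ Bpq r(2) unfolding column_pairs_def by blast
    qed (rule tw)
  qed
qed

lemma no_weight_pairs_krull_dim:
  assumes V: "V \<in> gr_prod n" and ech: "echelon n V J B" and e: "weight_pairs n B = {}"
  shows "krull_dim (subtopology (zariski n) (torus_orbit n V)) \<le> 0"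
proof (rule krull_dim_singleton)
  have ext: "V \<in> extensional {1..n}" using V by (simp add: gr_prod_def PiE_def)
  have fixed: "act n (torus_aut n t) V = V" if "t \<in> torus n" for t
    using act_torus_fixes_iff[OF ech that ext] e by simp
  have "(\<lambda>i\<in>{1..2*n}. 1) \<in> torus n" by (auto simp: torus_def)
  then have "torus_orbit n V = {V}" using fixed unfolding torus_orbit_def by force
  then show "topspace (subtopology (zariski n) (torus_orbit n V)) = {V}"
    using V by (simp add: topspace_zariski)
qed

section \<open>One-parameter families through a coordinate point\<close>

text \<open>
  The vertices at which adding a multiple of a homomorphism from \<open>R\<^sub>i\<close> to \<open>R\<^sub>j\<close> moves the coordinate point: both
  summands are present there, and of their two basis vectors the point contains the one of \<open>R\<^sub>i\<close> but not the
  one of \<open>R\<^sub>j\<close>.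
\<close>

definition bend :: "nat \<Rightarrow> (nat \<Rightarrow> nat set) \<Rightarrow> nat \<Rightarrow> nat \<Rightarrow> nat \<Rightarrow> bool" where
  "bend n S i j k \<longleftrightarrow> summand_index n k (basis_index n i) = i \<and>
     summand_index n k (basis_index n j) = j \<and> basis_index n i \<in> S k \<and> basis_index n j \<notin> S k"

definition bent_mat where
  "bent_mat n S i j c k p l =
     (if bend n S i j k \<and> p = basis_index n i \<and> l = basis_index n j then c else (0::complex))"

text \<open>
  The translate of \<open>coord_pt n S\<close> by \<open>Id + c\<gamma>\<close>, for \<open>\<gamma>\<close> normalised to \<open>std_hom n i j\<close>, written in echelon
  form. As each component is the graph of a matrix whose only possible non-zero entry is \<open>c\<close>, this shows the torus action and the dependence on
  \<open>c\<close> directly.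
\<close>

definition bent_pt :: "nat \<Rightarrow> (nat \<Rightarrow> nat set) \<Rightarrow> nat \<Rightarrow> nat \<Rightarrow> complex \<Rightarrow> (nat \<Rightarrow> cvec set)" where
  "bent_pt n S i j c = (\<lambda>k\<in>{1..n}. graph_space (S k) (bent_mat n S i j c k))"

lemma admissibleD:
  assumes "admissible n S" "k \<in> {1..n}"
  shows "S k \<subseteq> {1..n+1}" "card (S k) = k" "finite (S k)"
proof -
  show 1: "S k \<subseteq> {1..n+1}" and "card (S k) = k" using assms unfolding admissible_def by blast+
  show "finite (S k)" by (rule finite_subset[OF 1]) simp
qed

lemma admissible_step:
  "\<lbrakk>admissible n S; k \<in> {1..<n}; l \<in> S k; l \<noteq> k + 1\<rbrakk> \<Longrightarrow> l \<in> S (k + 1)"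
  unfolding admissible_def by blast

lemma hom_pairD:
  assumes "hom_pair n i j"
  shows "i \<in> {1..2*n}" "j \<in> {1..2*n}" "i < j" "basis_index n i \<in> {1..n+1}" "basis_index n j \<in> {1..n+1}"
  using assms by (auto simp: hom_pair_def basis_index_def)

lemma mem_bent_iff:
  assumes "finite (S k)"
  shows "v \<in> graph_space (S k) (bent_mat n S i j c k) \<longleftrightarrow>
    (\<forall>l. l \<notin> S k \<longrightarrow> v l = (if bend n S i j k \<and> l = basis_index n j then c * v (basis_index n i) else 0))"
proof -
  have "(\<Sum>p\<in>S k. bent_mat n S i j c k p l * v p) =
      (if bend n S i j k \<and> l = basis_index n j then c * v (basis_index n i) else 0)" for l
  proof (cases "bend n S i j k \<and> l = basis_index n j")
    case True
    then have "(\<Sum>p\<in>S k. bent_mat n S i j c k p l * v p) =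
        (\<Sum>p\<in>S k. if p = basis_index n i then c * v p else 0)"
      by (intro sum.cong) (auto simp: bent_mat_def)
    then show ?thesis using True assms by (simp add: bend_def)
  next
    case False
    then have "bent_mat n S i j c k p l = 0" for p by (auto simp: bent_mat_def)
    then show ?thesis unfolding if_not_P[OF False] by simp
  qed
  then show ?thesis by (simp add: graph_space_def)
qed

lemma mem_bent_pt_iff:
  assumes "admissible n S" "k \<in> {1..n}"
  shows "v \<in> bent_pt n S i j c k \<longleftrightarrow>
    (\<forall>l. l \<notin> S k \<longrightarrow> v l = (if bend n S i j k \<and> l = basis_index n j then c * v (basis_index n i) else 0))"
  using mem_bent_iff[of S k, OF admissibleD(3)[OF assms]] assms(2) by (simp add: bent_pt_def)

lemma span_w_image:
  assumes "finite X" shows "cvec.span (w ` X) = graph_space X (\<lambda>_ _. 0)"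
proof -
  have "w ` X = graph_vec X (\<lambda>_ _. 0) ` X"
    by (intro image_cong) (auto simp: w_def graph_vec_def fun_eq_iff)
  then show ?thesis using span_graph_vec[OF assms] by simp
qed

lemma coord_pt_eq_bent_pt:
  assumes "admissible n S" shows "coord_pt n S = bent_pt n S i j 0"
proof -
  have "bent_mat n S i j 0 k = (\<lambda>_ _. 0)" for k by (auto simp: bent_mat_def fun_eq_iff)
  then show ?thesis
    unfolding coord_pt_def bent_pt_def
    by (intro restrict_ext) (simp only: span_w_image[OF admissibleD(3)[OF assms]])
qed

lemma mem_coord_pt_iff:
  assumes "admissible n S" "k \<in> {1..n}"
  shows "v \<in> coord_pt n S k \<longleftrightarrow> (\<forall>l. l \<notin> S k \<longrightarrow> v l = 0)"
  using span_w_image[OF admissibleD(3)[OF assms]] assms(2) by (simp add: coord_pt_def graph_space_def)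

lemma w_in_coord_pt: "\<lbrakk>k \<in> {1..n}; l \<in> S k\<rbrakk> \<Longrightarrow> w l \<in> coord_pt n S k"
  by (auto simp: coord_pt_def intro: cvec.span_base)

lemma coord_pt_subset_W:
  assumes "admissible n S" "k \<in> {1..n}" shows "coord_pt n S k \<subseteq> W n"
  using mem_coord_pt_iff[OF assms] admissibleD(1)[OF assms] unfolding coord_space_def by blast

lemma bent_pt_gr_prod:
  assumes "admissible n S" "hom_pair n i j" shows "bent_pt n S i j c \<in> gr_prod n"
proof (rule gr_prodI)
  fix k assume k: "k \<in> {1..n}"
  show "S k \<subseteq> {1..n+1} \<and> card (S k) = k \<and>
      bent_pt n S i j c k = graph_space (S k) (bent_mat n S i j c k)"
    using admissibleD[OF assms(1) k] k by (simp add: bent_pt_def)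
  fix p l assume "bent_mat n S i j c k p l \<noteq> 0"
  then show "l \<in> {1..n+1}" using hom_pairD(5)[OF assms(2)] by (auto simp: bent_mat_def split: if_splits)
qed (simp add: bent_pt_def)

lemma summand_index_Suc: "l \<noteq> k + 1 \<Longrightarrow> summand_index n (k + 1) l = summand_index n k l"
  by (auto simp: summand_index_def)

lemma summand_index_le: "\<lbrakk>k \<in> {1..n}; l \<in> {1..n+1}\<rbrakk> \<Longrightarrow> summand_index n k l \<le> summand_index n k (k + 1)"
  by (auto simp: summand_index_def)

lemma summand_index_ge: "\<lbrakk>k \<in> {1..n}; l \<in> {1..n+1}\<rbrakk> \<Longrightarrow> summand_index n k k \<le> summand_index n k l"
  by (auto simp: summand_index_def)

text \<open>
  The only issue is whether the bent vector at \<open>k\<close> is carried to the one at \<open>k + 1\<close>. The arrow kills the basis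
  vector of index \<open>k + 1\<close>, which has the largest weight at \<open>k\<close> and the smallest weight at
  \<open>k + 1\<close>. As \<open>i < j\<close>, it is therefore neither the vector of \<open>R\<^sub>i\<close> at a bend \<open>k\<close> nor the vector of
  \<open>R\<^sub>j\<close> at a bend \<open>k + 1\<close>.
\<close>

lemma bent_pt_deg_flag:
  assumes "admissible n S" "hom_pair n i j" shows "bent_pt n S i j c \<in> deg_flag n"
proof -
  let ?a = "basis_index n i" and ?b = "basis_index n j"
  note h = hom_pairD[OF assms(2)]
  have "pr (k + 1) v \<in> bent_pt n S i j c (k + 1)"
    if k: "k \<in> {1..<n}" and v: "v \<in> bent_pt n S i j c k" for k v
  proof -
    have k1: "k \<in> {1..n}" "k + 1 \<in> {1..n}" using k by auto
    have v_out: "v l = (if bend n S i j k \<and> l = ?b then c * v ?a else 0)" if "l \<notin> S k" for l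
      using v that mem_bent_pt_iff[OF assms(1) k1(1)] by blast
    have "pr (k + 1) v l = (if bend n S i j (k + 1) \<and> l = ?b then c * pr (k + 1) v ?a else 0)"
      if l: "l \<notin> S (k + 1)" for l
    proof (cases "l = k + 1")
      case True
      have nb: "\<not> (bend n S i j (k + 1) \<and> l = ?b)"
        using summand_index_ge[OF k1(2) h(4)] h(3) True by (auto simp: bend_def)
      show ?thesis unfolding if_not_P[OF nb] using True by (simp add: pr_def)
    next
      case False
      then have lS: "l \<notin> S k" using admissible_step[OF assms(1) k] l by blast
      have *: "bend n S i j (k + 1) \<longleftrightarrow> bend n S i j k" if "l = ?b" "?a \<noteq> k + 1" "v ?a \<noteq> 0"
      proof -
        have "?a \<in> S k" 
        proof (rule ccontr)
          assume "?a \<notin> S k"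
          then show False using v_out[of ?a] that(3) by (auto simp: bend_def split: if_splits)
        qed
        then show ?thesis
          using admissible_step[OF assms(1) k _ that(2)] l lS False that(1,2)
          by (simp add: bend_def summand_index_Suc[unfolded Suc_eq_plus1[symmetric]])
      qed
      have "\<not> bend n S i j k" if "?a = k + 1"
        using summand_index_le[OF k1(1) h(5)] h(3) that by (auto simp: bend_def)
      then show ?thesis using * v_out[OF lS] False by (auto simp: pr_def)
    qed
    then show ?thesis
      using mem_bent_pt_iff[OF assms(1) k1(2)] by blast
  qed
  then show ?thesis using bent_pt_gr_prod[OF assms] by (auto simp: deg_flag_def)
qed

lemma act_torus_bent_pt:
  assumes "admissible n S" "hom_pair n i j" "t \<in> torus n"
  shows "act n (torus_aut n t) (bent_pt n S i j c) = bent_pt n S i j (c * (t j / t i))"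
proof -
  have "torus_aut n t k ` graph_space (S k) (bent_mat n S i j c k) =
      graph_space (S k) (bent_mat n S i j (c * (t j / t i)) k)" if k: "k \<in> {1..n}" for k
  proof -
    have "(\<lambda>p l. bent_mat n S i j c k p l * (t (summand_index n k l) / t (summand_index n k p))) =
        bent_mat n S i j (c * (t j / t i)) k"
      by (auto simp: fun_eq_iff bent_mat_def bend_def)
    moreover have "l \<in> {1..n+1}" if "bent_mat n S i j c k p l \<noteq> 0" for p l
      using that hom_pairD(5)[OF assms(2)] by (auto simp: bent_mat_def split: if_splits)
    ultimately show ?thesis
      using torus_aut_graph_space[OF assms(3) k admissibleD(1)[OF assms(1) k], of "bent_mat n S i j c k"]
      by simp
  qed
  then show ?thesis by (auto simp: act_def bent_pt_def fun_eq_iff)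
qed

lemma bent_pt_inject:
  assumes "admissible n S" "k \<in> {1..n}" "bend n S i j k" "bent_pt n S i j c = bent_pt n S i j d"
  shows "c = d"
proof -
  have "graph_space (S k) (bent_mat n S i j c k) = graph_space (S k) (bent_mat n S i j d k)"
    using fun_cong[OF assms(4), of k] assms(2) by (simp add: bent_pt_def)
  from graph_space_inj[OF this admissibleD(3)[OF assms(1,2)], of "basis_index n i" "basis_index n j"]
  show ?thesis using assms(3) by (simp add: bent_mat_def bend_def)
qed

lemma torus_orbit_bent_pt:
  assumes "admissible n S" "hom_pair n i j" "c \<noteq> 0"
  shows "torus_orbit n (bent_pt n S i j c) = bent_pt n S i j ` (UNIV - {0})"
proof -
  note h = hom_pairD[OF assms(2)]
  have "(\<lambda>t. c * (t j / t i)) ` torus n = UNIV - {0}"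
  proof (intro antisym subsetI)
    fix d assume "d \<in> (\<lambda>t. c * (t j / t i)) ` torus n"
    then show "d \<in> UNIV - {0}" using torus_nonzero h assms(3) by auto
  next
    fix d :: complex assume d: "d \<in> UNIV - {0}"
    define t where "t = (\<lambda>l\<in>{1..2*n}. if l = j then d / c else 1)"
    have "t \<in> torus n" using d assms(3) by (auto simp: t_def torus_def)
    moreover have "d = c * (t j / t i)" using h assms(3) by (simp add: t_def)
    ultimately show "d \<in> (\<lambda>t. c * (t j / t i)) ` torus n" by blast
  qed
  moreover have "torus_orbit n (bent_pt n S i j c) = bent_pt n S i j ` ((\<lambda>t. c * (t j / t i)) ` torus n)"
    unfolding torus_orbit_def image_image using act_torus_bent_pt[OF assms(1,2)] by (intro image_cong) auto
  ultimately show ?thesis by simp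
qed

text \<open>
  The family is a punctured line with polynomial frames, so an equation that does not vanish identically on it
  has finitely many zeros.
\<close>

lemma krull_dim_bent_family:
  assumes "admissible n S" "hom_pair n i j" "k \<in> {1..n}" "bend n S i j k"
  shows "krull_dim (subtopology (zariski n) (bent_pt n S i j ` (UNIV - {0}))) = 1"
proof -
  let ?L = "bent_pt n S i j ` (UNIV - {0})"
  have L: "?L \<subseteq> gr_prod n" using bent_pt_gr_prod[OF assms(1,2)] by blast
  then have top: "topspace (subtopology (zariski n) ?L) = ?L" by (auto simp: topspace_zariski)
  show ?thesis
  proof (rule krull_dim_eq_1)
    have "inj_on (bent_pt n S i j) (UNIV - {0})"
      using bent_pt_inject[OF assms(1,3,4)] by (auto intro: inj_onI)
    moreover have "infinite (UNIV - {0::complex})" by (simp add: infinite_UNIV_char_0)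
    ultimately show "infinite (topspace (subtopology (zariski n) ?L))"
      unfolding top using finite_imageD by blast
    have "?L = (\<lambda>t. act n (torus_aut n t) (bent_pt n S i j 1)) ` subtorus n {}"
      using torus_orbit_bent_pt[OF assms(1,2), of 1] by (simp add: torus_orbit_def subtorus_def)
    with irreducible_subtorus_orbit[OF bent_pt_gr_prod[OF assms(1,2)], of "{}" 1 ?L] L
    show "irreducible_in (subtopology (zariski n) ?L) (topspace (subtopology (zariski n) ?L))"
      unfolding top by simp
    fix V assume "V \<in> topspace (subtopology (zariski n) ?L)"
    then show "closedin (subtopology (zariski n) ?L) {V}"
      unfolding top closedin_subtopology closedin_zariski using zariski_closed_point L by blast
  next
    fix C assume C: "closedin (subtopology (zariski n) ?L) C" "C \<noteq> topspace (subtopology (zariski n) ?L)"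
    then obtain C' where C': "zariski_closed n C'" "C = C' \<inter> ?L"
      by (auto simp: closedin_subtopology closedin_zariski)
    then obtain d where d: "bent_pt n S i j d \<notin> C'" using C(2) unfolding top by blast
    have "\<exists>e. bij_betw e {1..k} (S k)" if "k \<in> {1..n}" for k
      using ex_bij_betw_nat_finite_1[OF admissibleD(3)[OF assms(1) that]] admissibleD(2)[OF assms(1) that] by simp
    then have "\<forall>k\<in>{1..n}. \<exists>e. bij_betw e {1..k} (S k)" by blast
    from bchoice[OF this] obtain e where e: "\<forall>k\<in>{1..n}. bij_betw (e k) {1..k} (S k)" ..
    define A where "A = (\<lambda>c k l. graph_vec (S k) (bent_mat n S i j c k) (e k l))"
    have fr: "A c \<in> frames_of n (bent_pt n S i j c)" for c
    proof -
      have "cvec.span (A c k ` {1..k}) = bent_pt n S i j c k" if k: "k \<in> {1..n}" for k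
      proof -
        have "A c k ` {1..k} = graph_vec (S k) (bent_mat n S i j c k) ` (e k ` {1..k})"
          by (simp add: A_def image_image)
        also have "e k ` {1..k} = S k" using e k bij_betw_imp_surj_on by blast
        finally show ?thesis
          using span_graph_vec[OF admissibleD(3)[OF assms(1) k]] k by (simp add: bent_pt_def)
      qed
      then show ?thesis by (simp add: frames_of_def)
    qed
    have poly: "\<forall>k l x. \<exists>p. \<forall>c. A c k l x = poly p c"
    proof (intro allI)
      fix k l x
      have "A c k l x = poly (if x \<in> S k then (if x = e k l then [:1:] else 0)
        else if bend n S i j k \<and> e k l = basis_index n i \<and> x = basis_index n j then [:0, 1:] else 0) c" for c
        by (simp add: A_def graph_vec_def bent_mat_def)
      then show "\<exists>p. \<forall>c. A c k l x = poly p c" by blast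
    qed
    obtain f where f: "f \<in> frame_poly n" "f (A d) \<noteq> 0"
      "\<And>V' A'. \<lbrakk>V' \<in> gr_prod n; A' \<in> frames_of n V'; f A' \<noteq> 0\<rbrakk> \<Longrightarrow> V' \<notin> C'"
      using zariski_closed_separate[OF C'(1) bent_pt_gr_prod[OF assms(1,2)] d fr] by blast
    obtain p where p: "\<And>c. f (A c) = poly p c" using frame_poly_along_curve[OF f(1) poly] by blast
    have "C \<subseteq> bent_pt n S i j ` {c. poly p c = 0}"
    proof
      fix V assume V: "V \<in> C"
      then obtain c where c: "V = bent_pt n S i j c" using C'(2) by blast
      have "f (A c) = 0" using f(3)[OF bent_pt_gr_prod[OF assms(1,2)] fr, of c] V c C'(2) by blast
      then show "V \<in> bent_pt n S i j ` {c. poly p c = 0}" using c p by simp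
    qed
    moreover have "p \<noteq> 0" using f(2) p by auto
    ultimately show "finite C" using poly_roots_finite finite_surj by blast
  qed
qed

section \<open>Effective pairs\<close>

lemma std_hom_apply:
  "std_hom n i j k v l = (if summand_index n k (basis_index n i) = i \<and>
     summand_index n k (basis_index n j) = j \<and> l = basis_index n j then v (basis_index n i) else 0)"
  by (auto simp: std_hom_def w_def)

lemma summand_index_interval:
  assumes "i \<in> {1..2*n}" "k1 \<le> k" "k \<le> k2" "k2 \<le> n"
    "summand_index n k1 (basis_index n i) = i" "summand_index n k2 (basis_index n i) = i"
  shows "summand_index n k (basis_index n i) = i"
  using assms by (auto simp: summand_index_def basis_index_def split: if_splits)

text \<open>
  The weight of the basis vector that is killed by the arrow differs before and after the arrow, as the vector
  passes from \<open>I\<^sub>k\<close> to \<open>P\<^bsub>k+1\<^esub>\<close>.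
\<close>

lemma not_both_summand_indices:
  "\<lbrakk>k < n; summand_index n k (k + 1) = i\<rbrakk> \<Longrightarrow> summand_index n (k + 1) (k + 1) \<noteq> i"
  by (auto simp: summand_index_def)

lemma End_M_expand:
  assumes "g \<in> End_M n" "k \<in> {1..n}" "v \<in> W n"
  shows "g k v = (\<Sum>l\<in>{1..n+1}. cscale (v l) (g k (w l)))"
proof -
  have add: "g k (x + y) = g k x + g k y" if "x \<in> W n" "y \<in> W n" for x y
    using assms(1,2) that by (simp add: End_M_def)
  have scale: "g k (cscale c x) = cscale c (g k x)" if "x \<in> W n" for c x
    using assms(1,2) that by (simp add: End_M_def)
  have W: "cvec.subspace (W n)" by (auto simp: coord_space_def intro!: cvec.subspaceI)
  have w: "w l \<in> W n" if "l \<in> {1..n+1}" for l using that by (auto simp: w_def coord_space_def)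
  have zero: "g k 0 = 0"
    using scale[OF cvec.subspace_0[OF W], of 0] by (simp only: cvec.scale_zero_left)
  have "(\<Sum>l\<in>X. cscale (v l) (w l)) \<in> W n \<and>
      g k (\<Sum>l\<in>X. cscale (v l) (w l)) = (\<Sum>l\<in>X. cscale (v l) (g k (w l)))"
    if "finite X" "X \<subseteq> {1..n+1}" for X
    using that
  proof (induction X)
    case empty
    show ?case unfolding sum.empty using zero cvec.subspace_0[OF W] by (rule conjI[rotated])
  next
    case (insert x X)
    then have x: "w x \<in> W n" and X: "(\<Sum>l\<in>X. cscale (v l) (w l)) \<in> W n"
      "g k (\<Sum>l\<in>X. cscale (v l) (w l)) = (\<Sum>l\<in>X. cscale (v l) (g k (w l)))" using w by blast+
    have cx: "cscale (v x) (w x) \<in> W n" by (rule cvec.subspace_scale[OF W x])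
    show ?case
      unfolding sum.insert[OF insert.hyps(1,2)] add[OF cx X(1)] scale[OF x] X(2)
      using cvec.subspace_add[OF W cx X(1)] by blast
  qed
  then have *: "g k (\<Sum>l\<in>{1..n+1}. cscale (v l) (w l)) = (\<Sum>l\<in>{1..n+1}. cscale (v l) (g k (w l)))"
    by blast
  have "v = (\<Sum>l\<in>{1..n+1}. cscale (v l) (w l))"
  proof
    fix l
    have "(\<Sum>x\<in>{1..n+1}. cscale (v x) (w x)) l = (\<Sum>x\<in>{1..n+1}. if x = l then v l else 0)"
      unfolding cvec_sum_apply by (intro sum.cong) (auto simp: w_def)
    also have "\<dots> = (if l \<in> {1..n+1} then v l else 0)" by (rule sum.delta) simp
    finally show "v l = (\<Sum>l\<in>{1..n+1}. cscale (v l) (w l)) l"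
      using assms(3) unfolding coord_space_def by (metis (mono_tags, lifting) mem_Collect_eq)
  qed
  then show ?thesis using * by metis
qed

text \<open>
  At every vertex where both summands are present, \<open>g\<close> sends the basis vector of one to a multiple \<open>c k\<close> of
  the basis vector of the other, and it vanishes elsewhere. These vertices form an interval, along which
  commutation with the arrows makes \<open>c\<close> constant.
\<close>

lemma Hom_R_scalar_multiple:
  assumes h: "hom_pair n i j" and g: "g \<in> Hom_R n i j" "nonzero_fam n g"
  shows "\<exists>c. c \<noteq> 0 \<and> (\<forall>k\<in>{1..n}. \<forall>v\<in>W n. g k v = cscale c (std_hom n i j k v))"
proof -
  let ?a = "basis_index n i" and ?b = "basis_index n j"
  note hp = hom_pairD[OF h]
  have End: "g \<in> End_M n" using g(1) by (simp add: Hom_R_def)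
  define K where "K = {k \<in> {1..n}. summand_index n k ?a = i \<and> summand_index n k ?b = j}"
  define c where "c = (\<lambda>k. g k (w ?a) ?b)"
  have form: "g k v = cscale (c k) (std_hom n i j k v)" if k: "k \<in> {1..n}" and v: "v \<in> W n" for k v
  proof -
    have other: "g k (w l) = 0" if l: "l \<in> {1..n+1}" "summand_index n k l \<noteq> i" for l
    proof -
      have s: "summand_index n k l \<in> {1..2*n}" by (rule summand_index_range[OF k l(1)])
      have "w l \<in> R n (summand_index n k l) k"
        unfolding R_eq_span[OF s k] basis_index_summand_index[OF k l(1)] by (simp add: cvec.span_base)
      then show ?thesis using g(1) s l(2) k unfolding Hom_R_def by blast
    qed
    have main: "g k (w ?a) = cscale (c k) (if summand_index n k ?b = j then w ?b else 0)"
      if "summand_index n k ?a = i"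
    proof -
      have "w ?a \<in> R n i k"
        unfolding R_eq_span[OF hp(1) k] using that by (simp add: cvec.span_base)
      then have "g k (w ?a) \<in> R n j k" using g(1) k unfolding Hom_R_def by blast
      then show ?thesis
        unfolding R_eq_span[OF hp(2) k]
        by (auto simp: cvec.span_singleton c_def w_def fun_eq_iff split: if_splits)
    qed
    show ?thesis
    proof (cases "summand_index n k ?a = i")
      case True
      have "cscale (v l) (g k (w l)) = 0" if "l \<in> {1..n+1} - {?a}" for l
      proof -
        have "summand_index n k l \<noteq> i"
          using that basis_index_summand_index[OF k, of l] by auto
        then show ?thesis using other[of l] that by simp
      qed
      then have "(\<Sum>l\<in>{1..n+1}. cscale (v l) (g k (w l))) = (\<Sum>l\<in>{?a}. cscale (v l) (g k (w l)))"
        using hp(4) by (intro sum.mono_neutral_right) auto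
      then have "g k v = cscale (v ?a) (g k (w ?a))" unfolding End_M_expand[OF End k v] by simp
      then show ?thesis using main[OF True] True by (auto simp: fun_eq_iff std_hom_apply w_def)
    next
      case False
      have "cscale (v l) (g k (w l)) = 0" if l: "l \<in> {1..n+1}" for l
      proof -
        have "summand_index n k l \<noteq> i" using False basis_index_summand_index[OF k l] by metis
        then show ?thesis using other[OF l] by simp
      qed
      then have "g k v = 0" unfolding End_M_expand[OF End k v] by (rule sum.neutral[OF ballI])
      then show ?thesis using False by (simp add: fun_eq_iff std_hom_apply)
    qed
  qed
  have step: "c (k + 1) = c k" if "k \<in> K" "k + 1 \<in> K" for k
  proof -
    have "k \<in> {1..<n}" "k < n" using that by (auto simp: K_def)
    have ab: "?a \<noteq> k + 1" "?b \<noteq> k + 1"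
      using that not_both_summand_indices[OF \<open>k < n\<close>] by (auto simp: K_def)
    have "w ?a \<in> W n" by (rule w_in_W[OF hp(1)])
    then have "g (k + 1) (pr (k + 1) (w ?a)) = pr (k + 1) (g k (w ?a))"
      using End \<open>k \<in> {1..<n}\<close> unfolding End_M_def by blast
    moreover have "pr (k + 1) (w ?a) = w ?a" using ab(1) by (auto simp: pr_def w_def fun_eq_iff)
    moreover have "pr (k + 1) (g k (w ?a)) ?b = g k (w ?a) ?b" using ab(2) by (simp add: pr_def)
    ultimately show ?thesis by (simp add: c_def)
  qed
  have up: "k \<in> K \<Longrightarrow> c k = c k1" if "k1 \<le> k" "k1 \<in> K" for k1 k
    using that(1)
  proof (induction k rule: dec_induct)
    case (step m)
    have "m \<in> K"
      using step.prems step.hyps that(2) summand_index_interval[OF hp(1), of k1 m "Suc m"]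
        summand_index_interval[OF hp(2), of k1 m "Suc m"] by (simp add: K_def)
    then show ?case using step.IH \<open>\<And>k. \<lbrakk>k \<in> K; k + 1 \<in> K\<rbrakk> \<Longrightarrow> c (k + 1) = c k\<close>[of m] step.prems by simp
  qed simp
  obtain k0 v0 where k0: "k0 \<in> {1..n}" "v0 \<in> W n" "g k0 v0 \<noteq> 0"
    using g(2) by (auto simp: nonzero_fam_def)
  have nz: "cscale (c k0) (std_hom n i j k0 v0) \<noteq> 0" using form[OF k0(1,2)] k0(3) by simp
  then have "c k0 \<noteq> 0" by (auto simp: fun_eq_iff)
  moreover have k0K: "k0 \<in> K"
    using nz k0(1) by (auto simp: K_def fun_eq_iff std_hom_apply split: if_splits)
  have "g k v = cscale (c k0) (std_hom n i j k v)" if k: "k \<in> {1..n}" and v: "v \<in> W n" for k v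
  proof (cases "k \<in> K")
    case True
    then have "c k = c k0" using up[of k k0] up[of k0 k] k0K by (metis nat_le_linear)
    then show ?thesis using form[OF k v] by simp
  next
    case False
    then have "std_hom n i j k v = 0" using k by (auto simp: K_def fun_eq_iff std_hom_apply)
    then show ?thesis using form[OF k v] by simp
  qed
  ultimately show ?thesis by blast
qed

text \<open>
  Outside the bends nothing changes: either the homomorphism vanishes on the span, or its image is already in
  the span.
\<close>

lemma act_unip_coord_pt:
  assumes S: "admissible n S" and h: "hom_pair n i j"
    and g: "\<forall>k\<in>{1..n}. \<forall>v\<in>W n. g k v = cscale d (std_hom n i j k v)"
  shows "act n (\<lambda>k v. v + cscale c (g k v)) (coord_pt n S) = bent_pt n S i j (c * d)"
proof
  fix k
  let ?a = "basis_index n i" and ?b = "basis_index n j"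
  note hp = hom_pairD[OF h]
  show "act n (\<lambda>k v. v + cscale c (g k v)) (coord_pt n S) k = bent_pt n S i j (c * d) k"
  proof (cases "k \<in> {1..n}")
    case k: True
    have ab: "?a \<noteq> ?b" if "summand_index n k ?a = i" "summand_index n k ?b = j"
      using that hp(3) by auto
    have "(\<lambda>v. v + cscale c (g k v)) ` coord_pt n S k =
        (\<lambda>v. v + cscale (c * d) (std_hom n i j k v)) ` coord_pt n S k"
      using g k coord_pt_subset_W[OF S k] by (intro image_cong) auto
    also have "\<dots> = bent_pt n S i j (c * d) k"
    proof (intro antisym subsetI)
      fix u assume "u \<in> (\<lambda>v. v + cscale (c * d) (std_hom n i j k v)) ` coord_pt n S k"
      then obtain v where v: "\<forall>l. l \<notin> S k \<longrightarrow> v l = 0"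
        and u: "u = v + cscale (c * d) (std_hom n i j k v)" using mem_coord_pt_iff[OF S k] by blast
      have "u l = (if bend n S i j k \<and> l = ?b then c * d * u ?a else 0)" if "l \<notin> S k" for l
        using that v ab by (auto simp: u std_hom_apply bend_def)
      then show "u \<in> bent_pt n S i j (c * d) k"
        using mem_bent_pt_iff[OF S k] by blast
    next
      fix u assume "u \<in> bent_pt n S i j (c * d) k"
      then have u: "u l = (if bend n S i j k \<and> l = ?b then c * d * u ?a else 0)" if "l \<notin> S k" for l
        using mem_bent_pt_iff[OF S k] that by blast
      define v where "v = u - cscale (c * d) (std_hom n i j k u)"
      have "v l = 0" if "l \<notin> S k" for l
        using u[OF that] u[of ?a] that ab by (auto simp: v_def std_hom_apply bend_def)
      then have "v \<in> coord_pt n S k" using mem_coord_pt_iff[OF S k] by blast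
      moreover have "u = v + cscale (c * d) (std_hom n i j k v)"
        using ab by (auto simp: v_def std_hom_apply fun_eq_iff)
      ultimately show "u \<in> (\<lambda>v. v + cscale (c * d) (std_hom n i j k v)) ` coord_pt n S k" by blast
    qed
    finally show ?thesis using k by (simp add: act_apply)
  qed (auto simp: act_def bent_pt_def)
qed

lemma effective_iff_bend:
  assumes S: "admissible n S" and g: "hom_pair n i j \<Longrightarrow> \<gamma> i j \<in> Hom_R n i j \<and> nonzero_fam n (\<gamma> i j)"
  shows "effective n \<gamma> S i j \<longleftrightarrow> hom_pair n i j \<and> (\<exists>k\<in>{1..n}. bend n S i j k)"
proof (cases "hom_pair n i j")
  case h: True
  let ?a = "basis_index n i" and ?b = "basis_index n j"
  obtain d where d: "d \<noteq> 0" "\<forall>k\<in>{1..n}. \<forall>v\<in>W n. \<gamma> i j k v = cscale d (std_hom n i j k v)"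
    using Hom_R_scalar_multiple[OF h] g[OF h] by blast
  have R: "R n i k = (if summand_index n k ?a = i then cvec.span {w ?a} else {0})" if "k \<in> {1..n}" for k
    by (rule R_eq_span[OF hom_pairD(1)[OF h] that])
  have 1: "\<exists>k\<in>{1..n}. bend n S i j k" if "effective n \<gamma> S i j"
  proof -
    have "\<exists>k\<in>{1..n}. \<not> \<gamma> i j k ` (coord_pt n S k \<inter> R n i k) \<subseteq> coord_pt n S k"
      using that by (simp only: effective_def)
    then obtain k where k: "k \<in> {1..n}"
      and "\<not> \<gamma> i j k ` (coord_pt n S k \<inter> R n i k) \<subseteq> coord_pt n S k" by (rule bexE)
    then obtain v where v: "v \<in> coord_pt n S k" "\<gamma> i j k v \<notin> coord_pt n S k" by blast
    then have "v \<in> W n" using coord_pt_subset_W[OF S k] by blast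
    then have "cscale d (std_hom n i j k v) \<notin> coord_pt n S k" using v(2) d(2) k by simp
    then obtain l where "l \<notin> S k" "cscale d (std_hom n i j k v) l \<noteq> 0"
      using mem_coord_pt_iff[OF S k] by blast
    then have "bend n S i j k"
      using v(1) mem_coord_pt_iff[OF S k, of v] by (auto simp: std_hom_apply bend_def split: if_splits)
    then show ?thesis using k by blast
  qed
  have 2: "effective n \<gamma> S i j" if k: "k \<in> {1..n}" and b: "bend n S i j k" for k
  proof -
    have "w ?a \<in> coord_pt n S k" using w_in_coord_pt[OF k] b by (simp add: bend_def)
    moreover have "w ?a \<in> R n i k" using R[OF k] b by (simp add: bend_def cvec.span_base)
    moreover have "w ?a \<noteq> 0" by (auto simp: w_def fun_eq_iff)
    moreover have "\<gamma> i j k (w ?a) ?b \<noteq> 0"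
      using d k w_in_W[OF hom_pairD(1)[OF h]] b by (simp add: std_hom_apply bend_def w_def)
    then have "\<gamma> i j k (w ?a) \<notin> coord_pt n S k"
      using mem_coord_pt_iff[OF S k] b by (auto simp: bend_def)
    ultimately show ?thesis using h k unfolding effective_def by blast
  qed
  show ?thesis using 1 2 h by blast
qed (simp add: effective_def)

lemma unip_orbit_eq_bent_family:
  assumes S: "admissible n S" and h: "hom_pair n i j"
    and g: "g \<in> Hom_R n i j" "nonzero_fam n g"
  shows "unip_orbit n g (coord_pt n S) = range (bent_pt n S i j)"
proof -
  obtain d where d: "d \<noteq> 0" "\<forall>k\<in>{1..n}. \<forall>v\<in>W n. g k v = cscale d (std_hom n i j k v)"
    using Hom_R_scalar_multiple[OF h g] by blast
  have "unip g = range (\<lambda>c k v. v + cscale c (g k v))" by (auto simp: unip_def)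
  then have "unip_orbit n g (coord_pt n S) = range (\<lambda>c. bent_pt n S i j (c * d))"
    using act_unip_coord_pt[OF S h d(2)] by (simp add: unip_orbit_def image_image)
  also have "\<dots> = bent_pt n S i j ` range (\<lambda>c. c * d)" by (simp add: image_image)
  also have "range (\<lambda>c. c * d) = UNIV"
    using d(1) by (intro surjI[where f = "\<lambda>c. c / d"]) simp
  finally show ?thesis .
qed

lemma unip_orbit_minus_point:
  assumes S: "admissible n S" and h: "hom_pair n i j"
    and g: "g \<in> Hom_R n i j" "nonzero_fam n g" and k: "k \<in> {1..n}" "bend n S i j k"
  shows "unip_orbit n g (coord_pt n S) - {coord_pt n S} = bent_pt n S i j ` (UNIV - {0})"
  using unip_orbit_eq_bent_family[OF S h g] coord_pt_eq_bent_pt[OF S, of i j]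
    bent_pt_inject[OF S k] by auto

section \<open>Orbits with a single weight\<close>

text \<open>
  An admissible collection can lose the index \<open>k + 1\<close> only between \<open>k\<close> and \<open>k + 1\<close>, and there the basis
  vector changes its summand.
\<close>

lemma admissible_propagate:
  assumes S: "admissible n S" and i: "i \<in> {1..2*n}" and le: "k1 \<le> k2" "1 \<le> k1" "k2 \<le> n"
    and pres: "summand_index n k1 (basis_index n i) = i" "summand_index n k2 (basis_index n i) = i"
    and mem: "basis_index n i \<in> S k1"
  shows "basis_index n i \<in> S k2"
  using le(1) le(3) pres(2)
proof (induction k2 rule: dec_induct)
  case base
  then show ?case using mem by simp
next
  case (step m)
  have "summand_index n m (basis_index n i) = i"
    by (rule summand_index_interval[OF i _ _ _ pres(1) step.prems(2)]) (use step in auto)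
  then have "basis_index n i \<in> S m" "basis_index n i \<noteq> m + 1"
    using step not_both_summand_indices[of m n i] by auto
  then show ?case using admissible_step[OF S, of m "basis_index n i"] step le(2) by simp
qed

lemma bend_interval:
  assumes S: "admissible n S" and h: "hom_pair n i j" and k: "k1 \<le> k" "k \<le> k2" "1 \<le> k1" "k2 \<le> n"
    and b: "bend n S i j k1" "bend n S i j k2"
  shows "bend n S i j k"
proof -
  note hp = hom_pairD[OF h]
  have i: "summand_index n k (basis_index n i) = i"
    by (rule summand_index_interval[OF hp(1) k(1,2,4)]) (use b in \<open>simp_all add: bend_def\<close>)
  have j: "summand_index n k (basis_index n j) = j"
    by (rule summand_index_interval[OF hp(2) k(1,2,4)]) (use b in \<open>simp_all add: bend_def\<close>)
  have "basis_index n i \<in> S k"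
    by (rule admissible_propagate[OF S hp(1) k(1,3) _ _ i]) (use b k in \<open>simp_all add: bend_def\<close>)
  moreover have "basis_index n j \<notin> S k"
  proof
    assume "basis_index n j \<in> S k"
    then have "basis_index n j \<in> S k2"
      using admissible_propagate[OF S hp(2) k(2) _ k(4) j] b(2) k by (simp add: bend_def)
    then show False using b(2) by (simp add: bend_def)
  qed
  ultimately show ?thesis using i j by (simp add: bend_def)
qed

lemma leading_index_in_pivots:
  assumes "v \<in> graph_space J B" "v p \<noteq> 0" "\<And>q. v q \<noteq> 0 \<Longrightarrow> key p \<le> (key q :: nat)"
    "\<And>q l. B q l \<noteq> 0 \<Longrightarrow> key q < key l"
  shows "p \<in> J"
proof (rule ccontr)
  assume "p \<notin> J"
  then have "v p = (\<Sum>q\<in>J. B q p * v q)" using assms(1) by (simp add: graph_space_def)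
  also have "\<dots> = 0"
  proof (rule sum.neutral[OF ballI])
    fix q show "B q p * v q = 0"
      using assms(3)[of q] assms(4)[of q p] by (cases "v q = 0"; cases "B q p = 0") auto
  qed
  finally show False using assms(2) by simp
qed

lemma pr_graph_vec_in:
  assumes V: "V \<in> deg_flag n" and ech: "echelon n V J B" and k: "k \<in> {1..<n}" and p: "p \<in> J k"
  shows "pr (k + 1) (graph_vec (J k) (B k) p) \<in> graph_space (J (k + 1)) (B (k + 1))"
proof -
  have k1: "k \<in> {1..n}" "k + 1 \<in> {1..n}" using k by auto
  have "graph_vec (J k) (B k) p \<in> V k"
    using graph_vec_in[OF echelonD(2)[OF ech k1(1)] p] echelonD(4)[OF ech k1(1)] by simp
  then have "pr (k + 1) (graph_vec (J k) (B k) p) \<in> V (k + 1)"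
    using V k unfolding deg_flag_def by blast
  then show ?thesis using echelonD(4)[OF ech k1(2)] by simp
qed

text \<open>
  The image of the row of a pivot \<open>p\<close> under the arrow still has its leading entry at \<open>p\<close>, because the arrow
  preserves the order of the weights of the vectors that it does not kill.
\<close>

lemma pivots_admissible:
  assumes V: "V \<in> deg_flag n" and ech: "echelon n V J B"
  shows "admissible n J"
proof -
  have "p \<in> J (k + 1)" if k: "k \<in> {1..<n}" and p: "p \<in> J k" "p \<noteq> k + 1" for k p
  proof (rule leading_index_in_pivots[OF pr_graph_vec_in[OF V ech k p(1)]])
    have k1: "k \<in> {1..n}" "k + 1 \<in> {1..n}" using k by auto
    show "pr (k + 1) (graph_vec (J k) (B k) p) p \<noteq> 0" using p by (simp add: pr_def graph_vec_def)
    fix q assume q: "pr (k + 1) (graph_vec (J k) (B k) p) q \<noteq> 0"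
    then have "q \<noteq> k + 1" "q = p \<or> B k p q \<noteq> 0"
      by (auto simp: pr_def graph_vec_def split: if_splits)
    then show "summand_index n (k + 1) p \<le> summand_index n (k + 1) q"
      using summand_index_Suc[OF p(2)] summand_index_Suc[of q k] echelonD(8)[OF ech k1(1), of p q]
      by fastforce
  next
    fix q l assume "B (k + 1) q l \<noteq> 0"
    then show "summand_index n (k + 1) q < summand_index n (k + 1) l"
      using echelonD(8)[OF ech, of "k + 1"] k by simp
  qed
  then show ?thesis
    unfolding admissible_def using echelonD(1,3)[OF ech] by blast
qed

text \<open>
  All non-zero entries sit in the row of \<open>R\<^sub>i\<close> and the column of \<open>R\<^sub>j\<close>, and only at bends. The bends form an interval
  of vertices, and the arrows carry the bent row at one bend to the bent row at the next, so all bends have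
  the same entry \<open>c\<close>.
\<close>

lemma single_weight_pair_bent_pt:
  assumes V: "V \<in> deg_flag n" and ech: "echelon n V J B" and wt: "weight_pairs n B = {(i, j)}"
  shows "hom_pair n i j" "\<exists>k\<in>{1..n}. bend n J i j k" "\<exists>c. c \<noteq> 0 \<and> V = bent_pt n J i j c"
proof -
  let ?a = "basis_index n i" and ?b = "basis_index n j"
  have S: "admissible n J" by (rule pivots_admissible[OF V ech])
  have B: "p = ?a \<and> l = ?b \<and> bend n J i j k" if k: "k \<in> {1..n}" and "B k p l \<noteq> 0" for k p l
  proof -
    note D = echelonD[OF ech k]
    have pl: "p \<in> J k" "l \<notin> J k" "p \<in> {1..n+1}" "l \<in> {1..n+1}" using D(1,5,6,7) that(2) by blast+
    have "(summand_index n k p, summand_index n k l) \<in> weight_pairs n B"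
      by (rule weight_pairsI[of k n B p l, OF k that(2)])
    then have "summand_index n k p = i" "summand_index n k l = j" by (simp_all add: wt)
    then show ?thesis using pl basis_index_summand_index[OF k] by (auto simp: bend_def)
  qed
  obtain k0 p0 l0 where k0: "k0 \<in> {1..n}" and "B k0 p0 l0 \<noteq> 0"
    and ij: "i = summand_index n k0 p0" "j = summand_index n k0 l0"
    using wt unfolding weight_pairs_def by blast
  then have B0: "B k0 ?a ?b \<noteq> 0" and bend0: "bend n J i j k0" and eq: "p0 = ?a" "l0 = ?b"
    using B[of k0 p0 l0] by auto
  have "p0 \<in> {1..n+1}" "l0 \<in> {1..n+1}"
    using echelonD(1,5,6)[OF ech k0] \<open>B k0 p0 l0 \<noteq> 0\<close> by blast+
  moreover have "i < j" using echelonD(8)[OF ech k0 \<open>B k0 p0 l0 \<noteq> 0\<close>] ij by simp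
  ultimately show h: "hom_pair n i j"
    using k0 unfolding hom_pair_def ij by (auto simp: summand_index_def)
  note hp = hom_pairD[OF h]
  show "\<exists>k\<in>{1..n}. bend n J i j k" using k0 bend0 by blast
  have step: "B (k + 1) ?a ?b = B k ?a ?b"
    if k: "k \<in> {1..<n}" and b: "bend n J i j k" "bend n J i j (k + 1)" for k
  proof -
    have k1: "k + 1 \<in> {1..n}" "k < n" using k by auto
    have ab: "?a \<noteq> k + 1" "?b \<noteq> k + 1"
      using b not_both_summand_indices[OF k1(2)] by (auto simp: bend_def)
    have aJ: "?a \<in> J k" "?a \<in> J (k + 1)" "?b \<notin> J k" "?b \<notin> J (k + 1)" using b by (auto simp: bend_def)
    let ?v = "pr (k + 1) (graph_vec (J k) (B k) ?a)"
    have "?v ?b = (\<Sum>p\<in>J (k + 1). B (k + 1) p ?b * ?v p)"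
      using pr_graph_vec_in[OF V ech k aJ(1)] aJ(4) unfolding graph_space_def by blast
    also have "\<dots> = (\<Sum>p\<in>{?a}. B (k + 1) p ?b * ?v p)"
      using B[OF k1(1)] aJ(2) echelonD(2)[OF ech k1(1)] by (intro sum.mono_neutral_right) auto
    finally show ?thesis using ab aJ by (simp add: pr_def graph_vec_def)
  qed
  have up: "B k ?a ?b = B k1 ?a ?b"
    if "k1 \<le> k" "1 \<le> k1" "k \<le> n" "bend n J i j k1" "bend n J i j k" for k1 k
    using that(1,3,5)
  proof (induction k rule: dec_induct)
    case (step m)
    have "bend n J i j m"
      by (rule bend_interval[OF S h _ _ that(2) _ that(4) step.prems(2)]) (use step in auto)
    then show ?case
      using step that(2) \<open>\<And>k. \<lbrakk>k \<in> {1..<n}; bend n J i j k; bend n J i j (k + 1)\<rbrakk> \<Longrightarrow> B (k + 1) ?a ?b = B k ?a ?b\<close>[of m]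
      by simp
  qed simp
  have const: "B k ?a ?b = B k0 ?a ?b" if "k \<in> {1..n}" "bend n J i j k" for k
    using up[of k k0] up[of k0 k] that k0 bend0 by (cases "k \<le> k0") auto
  have "B k = bent_mat n J i j (B k0 ?a ?b) k" if k: "k \<in> {1..n}" for k
  proof (intro ext)
    fix p l
    show "B k p l = bent_mat n J i j (B k0 ?a ?b) k p l"
    proof (cases "bend n J i j k \<and> p = ?a \<and> l = ?b")
      case True
      then show ?thesis unfolding bent_mat_def if_P[OF True] using const[OF k] by blast
    next
      case False
      then show ?thesis unfolding bent_mat_def if_not_P[OF False] using B[OF k, of p l] by blast
    qed
  qed
  then have "V k = bent_pt n J i j (B k0 ?a ?b) k" if "k \<in> {1..n}" for k
    using echelonD(4)[OF ech that] that by (simp add: bent_pt_def)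
  moreover have "V \<in> extensional {1..n}" using V by (simp add: deg_flag_def gr_prod_def PiE_def)
  ultimately have "V = bent_pt n J i j (B k0 ?a ?b)"
    by (intro extensionalityI[of _ "{1..n}"]) (auto simp: bent_pt_def)
  then show "\<exists>c. c \<noteq> 0 \<and> V = bent_pt n J i j c" using B0 by blast
qed

section \<open>Labels\<close>

lemma torus_stab_bent_pt:
  assumes S: "admissible n S" and h: "hom_pair n i j" and k: "k \<in> {1..n}" "bend n S i j k"
    and c: "c \<noteq> 0"
  shows "torus_stab n (bent_pt n S i j c) = {t \<in> torus n. t i = t j}"
proof -
  have "act n (torus_aut n t) (bent_pt n S i j c) = bent_pt n S i j c \<longleftrightarrow> t i = t j"
    if t: "t \<in> torus n" for t
  proof -
    have "t i \<noteq> 0" by (rule torus_nonzero[OF t hom_pairD(1)[OF h]])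
    then have "c * (t j / t i) = c \<longleftrightarrow> t i = t j" using c by (auto simp: field_simps)
    then show ?thesis
      unfolding act_torus_bent_pt[OF S h t] using bent_pt_inject[OF S k] by auto
  qed
  then show ?thesis unfolding torus_stab_def by blast
qed

lemma lie_alg_subtorus:
  assumes "i \<in> {1..2*n}" "j \<in> {1..2*n}"
  shows "lie_alg n {t \<in> torus n. t i = t j} = {x \<in> lie_torus n. x i = x j}"
proof -
  have "(\<forall>s. (\<lambda>i\<in>{1..2*n}. exp (s * x i)) \<in> {t \<in> torus n. t i = t j}) \<longleftrightarrow> x i = x j" for x :: cvec
  proof
    assume L: "\<forall>s. (\<lambda>i\<in>{1..2*n}. exp (s * x i)) \<in> {t \<in> torus n. t i = t j}"
    show "x i = x j"
    proof (rule ccontr)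
      assume ne: "x i \<noteq> x j"
      \<comment> \<open>This parameter makes the quotient of the two exponentials equal to \<open>exp 1\<close>.\<close>
      define s where "s = 1 / (x i - x j)"
      have "exp (s * x i) = exp (s * x j)" using spec[OF L, of s] assms by simp
      then have "exp (s * x i - s * x j) = 1" by (simp add: exp_diff)
      moreover have "s * x i - s * x j = of_real 1"
        unfolding right_diff_distrib[symmetric] using ne by (simp add: s_def)
      ultimately have "exp (of_real 1 :: complex) = of_real 1" by simp
      then have "exp (1 :: real) = 1" unfolding exp_of_real of_real_eq_iff .
      then show False by simp
    qed
  next
    assume "x i = x j"
    then show "\<forall>s. (\<lambda>i\<in>{1..2*n}. exp (s * x i)) \<in> {t \<in> torus n. t i = t j}"
      using assms by (auto simp: torus_def)
  qed
  then show ?thesis unfolding lie_alg_def by blast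
qed

lemma lie_torus_closed:
  "\<lbrakk>x \<in> lie_torus n; y \<in> lie_torus n\<rbrakk> \<Longrightarrow> x + y \<in> lie_torus n"
  "x \<in> lie_torus n \<Longrightarrow> cscale c x \<in> lie_torus n"
  by (auto simp: lie_torus_def coord_space_def sum.distrib simp flip: sum_distrib_left)

text \<open>
  A functional that vanishes on the hyperplane \<open>x i = x j\<close> is determined by its value at one vector outside the
  hyperplane; \<open>x0\<close> is a traceless choice, on which \<open>alpha n i j\<close> has the value \<open>2\<close>.
\<close>

lemma annihilator_alpha:
  assumes i: "i \<in> {1..2*n}" and j: "j \<in> {1..2*n}" and ne: "i \<noteq> j"
  shows "{\<phi> \<in> lie_dual n. (\<exists>x\<in>lie_torus n. \<phi> x \<noteq> 0) \<and>
    (\<forall>x\<in>lie_torus n. x i = x j \<longrightarrow> \<phi> x = 0)} = scalar_class n (alpha n i j)"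
proof -
  define x0 where "x0 = (\<lambda>l. if l = i then 1 else if l = j then - 1 else (0::complex))"
  have x0: "x0 \<in> lie_torus n"
  proof -
    have "(\<Sum>l\<in>{1..2*n}. x0 l) = (\<Sum>l\<in>{1..2*n}. if l = i then 1 else 0) -
        (\<Sum>l\<in>{1..2*n}. if l = j then 1 else 0)"
      unfolding sum_subtractf[symmetric] using ne by (intro sum.cong) (auto simp: x0_def)
    then show ?thesis using i j by (auto simp: lie_torus_def coord_space_def x0_def)
  qed
  have x0_ij: "x0 i = 1" "x0 j = - 1" using ne by (simp_all add: x0_def)
  show ?thesis
  proof (intro antisym subsetI)
    fix \<phi>
    assume \<phi>: "\<phi> \<in> {\<phi> \<in> lie_dual n. (\<exists>x\<in>lie_torus n. \<phi> x \<noteq> 0) \<and>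
      (\<forall>x\<in>lie_torus n. x i = x j \<longrightarrow> \<phi> x = 0)}"
    then have ext: "\<phi> \<in> extensional (lie_torus n)"
      and add: "\<And>x y. \<lbrakk>x \<in> lie_torus n; y \<in> lie_torus n\<rbrakk> \<Longrightarrow> \<phi> (x + y) = \<phi> x + \<phi> y"
      and scale: "\<And>c x. x \<in> lie_torus n \<Longrightarrow> \<phi> (cscale c x) = c * \<phi> x"
      by (auto simp: lie_dual_def)
    have val: "\<phi> x = \<phi> x0 / 2 * (x i - x j)" if x: "x \<in> lie_torus n" for x
    proof -
      define d where "d = (x i - x j) / 2"
      define y where "y = x + cscale (- d) x0"
      have "y \<in> lie_torus n" unfolding y_def by (intro lie_torus_closed x x0)
      moreover have "y i = y j" by (simp add: y_def x0_ij d_def field_simps)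
      ultimately have "\<phi> y = 0" using \<phi> by blast
      moreover have "\<phi> y = \<phi> x - d * \<phi> x0"
        unfolding y_def add[OF x lie_torus_closed(2)[OF x0]] scale[OF x0] by simp
      ultimately show ?thesis by (simp add: d_def field_simps)
    qed
    have "\<phi> x0 / 2 \<noteq> 0" using \<phi> val by fastforce
    moreover have "\<phi> = (\<lambda>x\<in>lie_torus n. \<phi> x0 / 2 * alpha n i j x)"
      using ext val by (intro extensionalityI[of _ "lie_torus n"]) (auto simp: alpha_def)
    ultimately show "\<phi> \<in> scalar_class n (alpha n i j)" unfolding scalar_class_def by blast
  next
    fix \<phi> assume "\<phi> \<in> scalar_class n (alpha n i j)"
    then obtain c where c: "c \<noteq> 0" "\<phi> = (\<lambda>x\<in>lie_torus n. c * alpha n i j x)"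
      unfolding scalar_class_def by blast
    have val: "\<phi> x = c * (x i - x j)" if "x \<in> lie_torus n" for x
      using that by (simp add: c alpha_def)
    have "\<phi> \<in> extensional (lie_torus n)" by (simp add: c(2))
    moreover have "\<phi> (x + y) = \<phi> x + \<phi> y" if "x \<in> lie_torus n" "y \<in> lie_torus n" for x y
      using that by (simp add: val lie_torus_closed algebra_simps)
    moreover have "\<phi> (cscale d x) = d * \<phi> x" if "x \<in> lie_torus n" for d x
      using that by (simp add: val lie_torus_closed algebra_simps)
    ultimately have "\<phi> \<in> lie_dual n" unfolding lie_dual_def by blast
    moreover have "\<phi> x0 \<noteq> 0" using val[OF x0] c(1) x0_ij by simp
    ultimately show "\<phi> \<in> {\<phi> \<in> lie_dual n. (\<exists>x\<in>lie_torus n. \<phi> x \<noteq> 0) \<and>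
      (\<forall>x\<in>lie_torus n. x i = x j \<longrightarrow> \<phi> x = 0)}" using val x0 by auto
  qed
qed

lemma labels_bent_family:
  assumes S: "admissible n S" and h: "hom_pair n i j" and k: "k \<in> {1..n}" "bend n S i j k"
  shows "labels (flag_moment_graph n) (bent_pt n S i j ` (UNIV - {0})) = scalar_class n (alpha n i j)"
proof -
  note hp = hom_pairD[OF h]
  have lie: "lie_alg n (torus_stab n V) = {x \<in> lie_torus n. x i = x j}"
    if "V \<in> bent_pt n S i j ` (UNIV - {0})" for V
    using that torus_stab_bent_pt[OF S h k] lie_alg_subtorus[OF hp(1,2)] by auto
  have "bent_pt n S i j 1 \<in> bent_pt n S i j ` (UNIV - {0})" by simp
  then have "(\<forall>V\<in>bent_pt n S i j ` (UNIV - {0}). \<forall>x\<in>lie_alg n (torus_stab n V). \<phi> x = 0) \<longleftrightarrow>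
      (\<forall>x\<in>lie_torus n. x i = x j \<longrightarrow> \<phi> x = 0)" for \<phi> :: "cvec \<Rightarrow> complex"
    using lie by blast
  then show ?thesis
    using annihilator_alpha[OF hp(1,2)] hp(3) by (simp add: flag_moment_graph_def)
qed

section \<open>The moment graph of the degenerate flag variety\<close>

lemma finite_coord_pts: "finite {coord_pt n S | S. admissible n S}"
proof (rule finite_subset)
  show "{coord_pt n S | S. admissible n S} \<subseteq> coord_pt n ` ({1..n} \<rightarrow>\<^sub>E Pow {1..n+1})"
  proof
    fix p assume "p \<in> {coord_pt n S | S. admissible n S}"
    then obtain S where S: "admissible n S" "p = coord_pt n S" by blast
    have "coord_pt n S = coord_pt n (restrict S {1..n})"
      unfolding coord_pt_def by (intro restrict_ext) simp
    moreover have "restrict S {1..n} \<in> {1..n} \<rightarrow>\<^sub>E Pow {1..n+1}"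
      using admissibleD(1)[OF S(1)] by auto
    ultimately show "p \<in> coord_pt n ` ({1..n} \<rightarrow>\<^sub>E Pow {1..n+1})" using S(2) by blast
  qed
  show "finite (coord_pt n ` ({1..n} \<rightarrow>\<^sub>E Pow {1..n+1}))"
    by (intro finite_imageI finite_PiE) auto
qed

lemma one_dim_orbit_is_bent_family:
  assumes "L \<in> one_dim_orbits n"
  obtains S i j k where "admissible n S" "hom_pair n i j" "k \<in> {1..n}" "bend n S i j k"
    "L = bent_pt n S i j ` (UNIV - {0})"
proof -
  obtain V where V: "V \<in> deg_flag n" "L = torus_orbit n V"
    and dim: "krull_dim (subtopology (zariski n) L) = 1"
    using assms unfolding one_dim_orbits_def by blast
  have gr: "V \<in> gr_prod n" using V(1) by (simp add: deg_flag_def)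
  obtain J B where ech: "echelon n V J B" using echelon_exists[OF gr] by blast
  have "weight_pairs n B \<noteq> {}"
    using no_weight_pairs_krull_dim[OF gr ech] dim V(2) by auto
  then obtain e where e: "e \<in> weight_pairs n B" by blast
  have "e' = e" if "e' \<in> weight_pairs n B" for e'
  proof (rule ccontr)
    assume "e' \<noteq> e"
    from two_weight_pairs_krull_dim[OF gr ech that e this] dim V(2)
    have "(2::enat) \<le> 1" by simp
    then show False by (simp add: one_enat_def numeral_eq_enat)
  qed
  then have "weight_pairs n B \<subseteq> {e}" by (simp add: subset_iff)
  then have "weight_pairs n B = {(fst e, snd e)}" using e by (metis empty_iff prod.collapse subset_singletonD)
  note * = single_weight_pair_bent_pt[OF V(1) ech this]
  obtain k where k: "k \<in> {1..n}" "bend n J (fst e) (snd e) k" using *(2) by blast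
  obtain c where c: "c \<noteq> 0" "V = bent_pt n J (fst e) (snd e) c" using *(3) by blast
  have S: "admissible n J" by (rule pivots_admissible[OF V(1) ech])
  show thesis
    by (rule that[OF S *(1) k]) (simp only: V(2) c(2) torus_orbit_bent_pt[OF S *(1) c(1)])
qed

lemma bent_family_is_one_dim_orbit:
  assumes "admissible n S" "hom_pair n i j" "k \<in> {1..n}" "bend n S i j k"
  shows "bent_pt n S i j ` (UNIV - {0}) \<in> one_dim_orbits n"
proof -
  have "bent_pt n S i j ` (UNIV - {0}) = torus_orbit n (bent_pt n S i j 1)"
    using torus_orbit_bent_pt[OF assms(1,2), of 1] by simp
  then show ?thesis
    using krull_dim_bent_family[OF assms] bent_pt_deg_flag[OF assms(1,2)]
    unfolding one_dim_orbits_def by blast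
qed

theorem theorem1p1:
  fixes n :: nat and \<gamma> :: "nat \<Rightarrow> nat \<Rightarrow> cfam"
  assumes "n \<ge> 1"
    and "\<And>i j. hom_pair n i j \<Longrightarrow> \<gamma> i j \<in> Hom_R n i j \<and> nonzero_fam n (\<gamma> i j)"
  shows "finite (one_dim_orbits n) \<and>
    one_dim_orbits n =
      {unip_orbit n (\<gamma> i j) (coord_pt n S) - {coord_pt n S} | S i j.
         admissible n S \<and> effective n \<gamma> S i j} \<and>
    (\<forall>S i j. admissible n S \<and> effective n \<gamma> S i j \<longrightarrow>
      unip_orbit n (\<gamma> i j) (coord_pt n S) - {coord_pt n S} \<in> edges (flag_moment_graph n) \<and>
      labels (flag_moment_graph n) (unip_orbit n (\<gamma> i j) (coord_pt n S) - {coord_pt n S})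
        = scalar_class n (alpha n i j))"
proof -
  let ?O = "\<lambda>S i j. unip_orbit n (\<gamma> i j) (coord_pt n S) - {coord_pt n S}"
  have eff: "effective n \<gamma> S i j \<longleftrightarrow> hom_pair n i j \<and> (\<exists>k\<in>{1..n}. bend n S i j k)"
    if "admissible n S" for S i j
    by (rule effective_iff_bend[OF that assms(2)])
  have orb: "?O S i j = bent_pt n S i j ` (UNIV - {0})"
    if S: "admissible n S" and h: "hom_pair n i j" and k: "k \<in> {1..n}" "bend n S i j k" for S i j k
    using assms(2)[OF h] unip_orbit_minus_point[OF S h _ _ k] by blast
  have edge: "?O S i j \<in> one_dim_orbits n \<and>
      labels (flag_moment_graph n) (?O S i j) = scalar_class n (alpha n i j)"
    if S: "admissible n S" and e: "effective n \<gamma> S i j" for S i j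
  proof -
    obtain k where h: "hom_pair n i j" and k: "k \<in> {1..n}" "bend n S i j k"
      using eff[OF S, of i j] e by blast
    show ?thesis
      unfolding orb[OF S h k] using bent_family_is_one_dim_orbit[OF S h k] labels_bent_family[OF S h k] ..
  qed
  have orbits: "one_dim_orbits n = {?O S i j | S i j. admissible n S \<and> effective n \<gamma> S i j}"
  proof (intro antisym subsetI)
    fix L assume "L \<in> one_dim_orbits n"
    then obtain S i j k where *: "admissible n S" "hom_pair n i j" "k \<in> {1..n}" "bend n S i j k"
      and L: "L = bent_pt n S i j ` (UNIV - {0})" by (rule one_dim_orbit_is_bent_family)
    have "effective n \<gamma> S i j" using eff[OF *(1), of i j] *(2-4) by blast
    moreover have "L = ?O S i j" using L orb[OF *] by simp
    ultimately show "L \<in> {?O S i j | S i j. admissible n S \<and> effective n \<gamma> S i j}" using *(1) by blast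
  qed (use edge in blast)
  \<comment> \<open>The collections \<open>S\<close> are arbitrary outside \<open>{1..n}\<close>, so there are infinitely many; their points are finitely many.\<close>
  have "one_dim_orbits n \<subseteq> (\<lambda>(p, i, j). unip_orbit n (\<gamma> i j) p - {p}) `
      ({coord_pt n S | S. admissible n S} \<times> {1..2*n} \<times> {1..2*n})"
  proof
    fix L assume "L \<in> one_dim_orbits n"
    then obtain S i j where S: "admissible n S" "effective n \<gamma> S i j" and L: "L = ?O S i j"
      unfolding orbits by blast
    have "hom_pair n i j" using S(2) by (simp add: effective_def)
    then have "(coord_pt n S, i, j) \<in> {coord_pt n S | S. admissible n S} \<times> {1..2*n} \<times> {1..2*n}"
      using hom_pairD(1,2) S(1) by blast
    then show "L \<in> (\<lambda>(p, i, j). unip_orbit n (\<gamma> i j) p - {p}) `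
        ({coord_pt n S | S. admissible n S} \<times> {1..2*n} \<times> {1..2*n})"
      unfolding L by (rule rev_image_eqI) simp
  qed
  moreover have "finite ({coord_pt n S | S. admissible n S} \<times> {1..2*n} \<times> {1..2*n})"
    using finite_coord_pts by simp
  ultimately have fin: "finite (one_dim_orbits n)" by (meson finite_imageI finite_subset)
  have edges: "edges (flag_moment_graph n) = one_dim_orbits n" by (simp add: flag_moment_graph_def)
  show ?thesis
    unfolding edges
  proof (intro conjI allI impI)
    fix S i j assume "admissible n S \<and> effective n \<gamma> S i j"
    then have *: "admissible n S" "effective n \<gamma> S i j" by simp_all
    show "?O S i j \<in> one_dim_orbits n" by (rule conjunct1[OF edge[OF *]])
    show "labels (flag_moment_graph n) (?O S i j) = scalar_class n (alpha n i j)"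
      by (rule conjunct2[OF edge[OF *]])
  qed (fact fin orbits)+
qed

end
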